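(* Let $m\geq 2$, $n\geq2$, $S=S_A$ a free profinite group on $A$, and $N$ a closed normal subgroup of $S$ with $N\leq S_{n,\mathbb{Z}/m}$. Let $w=(a_1,\dots,a_n)\in A^*$ and let $(c_{ij})$ be any defining system of size $n$ in $C^\bullet(S/N,\mathbb{Z}/m)$ with $[c_{ii}]=\epsilon_{(a_i),\mathbb{Z}/m}$ in $H^1(S/N)$ for $i=1,\dots,n$, and set $\psi_w=[\widetilde c_{1n}]\in H^2(S/N)$. Then for every $\sigma\in N$, $(\sigma N^m[S,N],\psi_w)'=\epsilon_{w,\mathbb{Z}/m}(\sigma)$.
   Context: $S_A$ is the free profinite group on $A$. The Magnus homomorphism $\Lambda\colon S\to(\mathbb{Z}/m)\langle\langle X_A\rangle\rangle^\times$ is the continuous homomorphism into the profinite ring of formal power series in non-commuting variables $X_a$ with $a\mapsto 1+X_a$; write $\Lambda(\sigma)=\sum_{w\in A^*}\epsilon_{w,\mathbb{Z}/m}(\sigma)X_w$. $S_{n,\mathbb{Z}/m}$ is the set of $\sigma$ with $\epsilon_{w,\mathbb{Z}/m}(\sigma)=0$ for $1\le|w|<n$. For $a\in A$, $\epsilon_{(a),\mathbb{Z}/m}\colon S\to\mathbb{Z}/m$ is a homomorphism trivial on $N$, hence an element of $H^1(S/N)=\operatorname{Hom}(S/N,\mathbb{Z}/m)$. Cohomology $H^i(\Gamma)=H^i(\Gamma,\mathbb{Z}/m)$ (trivial action) via continuous inhomogeneous cochains, $(\partial c)(\sigma,\tau)=c(\sigma)+c(\tau)-c(\sigma\tau)$,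 $(c\cup c')(\sigma,\tau)=c(\sigma)c'(\tau)$. A defining system of size $n$: $c_{ij}\in C^1$, $1\le i\le j\le n$, $(i,j)\ne(1,n)$, with $\partial c_{ij}=\widetilde c_{ij}:=-\sum_{r=i}^{j-1}c_{ir}\cup c_{r+1,j}$; $\widetilde c_{1n}$ is then a 2-cocycle. Since $N\le S^m[S,S]$ and $H^2(S)=0$, the transgression $\operatorname{trg}\colon H^1(N)^S\to H^2(S/N)$ is an isomorphism, and $(\cdot,\cdot)'\colon N/N^m[S,N]\times H^2(S/N)\to\mathbb{Z}/m$ is defined by $(\sigma N^m[S,N],\alpha)'=(\operatorname{trg}^{-1}(\alpha))(\sigma)$. *)

theory Defs
  imports
    "HOL-Algebra.Algebra"
    "HOL-Analysis.Analysis"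
    "Berlekamp_Zassenhaus.Finite_Field"
begin

text \<open>
  A group with a topology is a pair of a \<^typ>\<open>'g monoid\<close> and a \<^typ>\<open>'g topology\<close> with the same
  underlying set.  Functions on carriers (homomorphisms, cochains, power series) are kept
  \<^const>\<open>extensional\<close>, so that equality of functions means equality on the carrier.
\<close>

section \<open>Profinite groups\<close>

locale profinite_group = group G for G (structure) and T +
  assumes topspace_eq: "topspace T = carrier G"
    and continuous_mult: "continuous_map (prod_topology T T) T (\<lambda>(x, y). x \<otimes> y)"
    and continuous_inv: "continuous_map T T (\<lambda>x. inv x)"
    and compact: "compact_space T"
    and Hausdorff: "Hausdorff_space T"
    and totally_disconnected: "connectedin T C \<Longrightarrow> \<exists>x. C \<subseteq> {x}"

definition continuous_hom ::
  "'g monoid \<Rightarrow> 'g topology \<Rightarrow> 'h monoid \<Rightarrow> 'h topology \<Rightarrow> ('g \<Rightarrow> 'h) set" where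
  "continuous_hom G T H U =
     {h \<in> hom G H. h \<in> extensional (carrier G) \<and> continuous_map T U h}"

definition converges_to_one :: "'a set \<Rightarrow> 'g monoid \<Rightarrow> 'g topology \<Rightarrow> ('a \<Rightarrow> 'g) \<Rightarrow> bool" where
  "converges_to_one A G T f \<longleftrightarrow>
     f \<in> A \<rightarrow> carrier G \<and> (\<forall>U. openin T U \<and> \<one>\<^bsub>G\<^esub> \<in> U \<longrightarrow> finite {a \<in> A. f a \<notin> U})"

text \<open>
  The free profinite group on a set \<open>A\<close>: the basis converges to 1 (no condition when \<open>A\<close> is finite)
  and generates topologically, and every map from \<open>A\<close> to a profinite group that converges to 1
  extends uniquely to a continuous homomorphism.

  A formula cannot quantify over all types, so the target groups have carriers in the type
  \<^typ>\<open>('a list \<times> nat) set\<close>.  This is no restriction: we may replace a target by the closed subgroup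
  generated by the image of \<open>A\<close>; this has at most \<open>max(|A|, aleph_0)\<close> open normal subgroups, hence
  embeds into a product of that many finite groups, and so has at most \<open>2 ^ max(|A|, aleph_0)\<close>
  elements and is isomorphic, as a topological group, to one with carrier in that type.
\<close>

locale free_profinite_group = profinite_group S T for A :: "'a set" and S :: "'s monoid" (structure) and T
  and \<iota> :: "'a \<Rightarrow> 's" +
  assumes basis_converges: "converges_to_one A S T \<iota>"
    and basis_generates: "Abstract_Topology.closure_of T (generate S (\<iota> ` A)) = carrier S"
    and universal: "\<And>(G :: ('a list \<times> nat) set monoid) U \<phi>.
      \<lbrakk>profinite_group G U; converges_to_one A G U \<phi>\<rbrakk>
        \<Longrightarrow> \<exists>!h. h \<in> continuous_hom S T G U \<and> (\<forall>a\<in>A. h (\<iota> a) = \<phi> a)"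

definition quotient_topology :: "'g monoid \<Rightarrow> 'g topology \<Rightarrow> 'g set \<Rightarrow> 'g set topology" where
  "quotient_topology G T N = topology (\<lambda>V.
     V \<subseteq> carrier (G Mod N) \<and> openin T {x \<in> topspace T. N #>\<^bsub>G\<^esub> x \<in> V})"

lemma openin_quotient_topology:
  "openin (quotient_topology G T N) V \<longleftrightarrow>
     V \<subseteq> carrier (G Mod N) \<and> openin T {x \<in> topspace T. N #>\<^bsub>G\<^esub> x \<in> V}"
proof -
  have "istopology (\<lambda>V. V \<subseteq> carrier (G Mod N) \<and> openin T {x \<in> topspace T. N #>\<^bsub>G\<^esub> x \<in> V})"
    unfolding istopology_def
  proof (intro conjI allI impI; (elim conjE)?)
    fix V W
    assume "openin T {x \<in> topspace T. N #>\<^bsub>G\<^esub> x \<in> V}" "openin T {x \<in> topspace T. N #>\<^bsub>G\<^esub> x \<in> W}"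
    moreover have "{x \<in> topspace T. N #>\<^bsub>G\<^esub> x \<in> V \<inter> W} =
        {x \<in> topspace T. N #>\<^bsub>G\<^esub> x \<in> V} \<inter> {x \<in> topspace T. N #>\<^bsub>G\<^esub> x \<in> W}"
      by blast
    ultimately show "openin T {x \<in> topspace T. N #>\<^bsub>G\<^esub> x \<in> V \<inter> W}"
      by (simp only: openin_Int)
  next
    fix \<V>
    assume "\<forall>V\<in>\<V>. V \<subseteq> carrier (G Mod N) \<and> openin T {x \<in> topspace T. N #>\<^bsub>G\<^esub> x \<in> V}"
    moreover have "{x \<in> topspace T. N #>\<^bsub>G\<^esub> x \<in> \<Union>\<V>} =
        (\<Union>V\<in>\<V>. {x \<in> topspace T. N #>\<^bsub>G\<^esub> x \<in> V})"
      by blast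
    ultimately show "openin T {x \<in> topspace T. N #>\<^bsub>G\<^esub> x \<in> \<Union>\<V>}"
      by auto
  qed blast+
  then show ?thesis
    by (simp add: quotient_topology_def topology_inverse')
qed

text \<open>\<open>powers_commutators G T N m\<close> is \<open>N^m [G, N]\<close>, in the profinite sense, i.e. closed.\<close>

definition powers_commutators :: "'g monoid \<Rightarrow> 'g topology \<Rightarrow> 'g set \<Rightarrow> nat \<Rightarrow> 'g set" where
  "powers_commutators G T N m = Abstract_Topology.closure_of T (generate G
     ({\<nu> [^]\<^bsub>G\<^esub> m | \<nu>. \<nu> \<in> N} \<union>
      {inv\<^bsub>G\<^esub> \<sigma> \<otimes>\<^bsub>G\<^esub> inv\<^bsub>G\<^esub> \<nu> \<otimes>\<^bsub>G\<^esub> \<sigma> \<otimes>\<^bsub>G\<^esub> \<nu> | \<sigma> \<nu>. \<sigma> \<in> carrier G \<and> \<nu> \<in> N}))"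


section \<open>The Magnus homomorphism\<close>

text \<open>
  \<open>power_series A\<close> is the ring of formal power series over \<open>'r\<close> in non-commuting variables \<open>X_a\<close>,
  \<open>a \<in> A\<close>; a series is the function taking a word in \<open>A\<close> to its coefficient.  Its topology is the
  product topology of the discrete topologies on the coefficients.
\<close>

definition power_series :: "'a set \<Rightarrow> ('a list \<Rightarrow> 'r::comm_ring_1) ring" where
  "power_series A =
     \<lparr>carrier = lists A \<rightarrow>\<^sub>E UNIV,
      Group.monoid.mult = (\<lambda>f g. \<lambda>w\<in>lists A. \<Sum>k\<le>length w. f (take k w) * g (drop k w)),
      Group.monoid.one = (\<lambda>w\<in>lists A. if w = [] then 1 else 0),
      ring.zero = (\<lambda>w\<in>lists A. 0),
      ring.add = (\<lambda>f g. \<lambda>w\<in>lists A. f w + g w)\<rparr>"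

definition power_series_topology :: "'a set \<Rightarrow> ('a list \<Rightarrow> 'r::comm_ring_1) topology" where
  "power_series_topology A = product_topology (\<lambda>w. discrete_topology UNIV) (lists A)"

definition series_var :: "'a set \<Rightarrow> 'a \<Rightarrow> 'a list \<Rightarrow> 'r::comm_ring_1" where
  "series_var A a = (\<lambda>w\<in>lists A. if w = [a] then 1 else 0)"

definition magnus :: "'a set \<Rightarrow> 's monoid \<Rightarrow> 's topology \<Rightarrow> ('a \<Rightarrow> 's) \<Rightarrow> 's \<Rightarrow> 'a list \<Rightarrow> 'r::comm_ring_1" where
  "magnus A S T \<iota> = (THE \<Lambda>.
     \<Lambda> \<in> continuous_hom S T (units_of (power_series A))
           (subtopology (power_series_topology A) (Units (power_series A))) \<and>
     (\<forall>a\<in>A. \<Lambda> (\<iota> a) = \<one>\<^bsub>power_series A\<^esub> \<oplus>\<^bsub>power_series A\<^esub> series_var A a))"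

definition magnus_coeff ::
  "'a set \<Rightarrow> 's monoid \<Rightarrow> 's topology \<Rightarrow> ('a \<Rightarrow> 's) \<Rightarrow> 'a list \<Rightarrow> 's \<Rightarrow> 'r::comm_ring_1" where
  "magnus_coeff A S T \<iota> w \<sigma> = magnus A S T \<iota> \<sigma> w"

text \<open>The set \<open>S_{n,R}\<close>; the coefficient ring \<open>R\<close> is given by its type.\<close>

definition magnus_filtration ::
  "'a set \<Rightarrow> 's monoid \<Rightarrow> 's topology \<Rightarrow> ('a \<Rightarrow> 's) \<Rightarrow> 'r::comm_ring_1 itself \<Rightarrow> nat \<Rightarrow> 's set" where
  "magnus_filtration A S T \<iota> _ n =
     {\<sigma> \<in> carrier S. \<forall>w\<in>lists A. 1 \<le> length w \<and> length w < n \<longrightarrow>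
        magnus_coeff A S T \<iota> w \<sigma> = (0::'r)}"


section \<open>Continuous cohomology with trivial discrete coefficients\<close>

definition C1 :: "'g monoid \<Rightarrow> 'g topology \<Rightarrow> ('g \<Rightarrow> 'r::comm_ring_1) set" where
  "C1 G T = {c \<in> extensional (carrier G). continuous_map T (discrete_topology UNIV) c}"

definition C2 :: "'g monoid \<Rightarrow> 'g topology \<Rightarrow> ('g \<times> 'g \<Rightarrow> 'r::comm_ring_1) set" where
  "C2 G T = {c \<in> extensional (carrier G \<times> carrier G).
     continuous_map (prod_topology T T) (discrete_topology UNIV) c}"

definition coboundary :: "'g monoid \<Rightarrow> ('g \<Rightarrow> 'r::comm_ring_1) \<Rightarrow> 'g \<times> 'g \<Rightarrow> 'r" where
  "coboundary G c = (\<lambda>(\<sigma>, \<tau>)\<in>carrier G \<times> carrier G. c \<sigma> + c \<tau> - c (\<sigma> \<otimes>\<^bsub>G\<^esub> \<tau>))"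

definition cup :: "'g monoid \<Rightarrow> ('g \<Rightarrow> 'r::comm_ring_1) \<Rightarrow> ('g \<Rightarrow> 'r) \<Rightarrow> 'g \<times> 'g \<Rightarrow> 'r" where
  "cup G c c' = (\<lambda>(\<sigma>, \<tau>)\<in>carrier G \<times> carrier G. c \<sigma> * c' \<tau>)"

text \<open>
  Since the action is trivial, there are no nonzero 1-coboundaries: \<open>H^1\<close> is the group of
  1-cocycles, i.e. of continuous homomorphisms into the coefficients.
\<close>

definition H1 :: "'g monoid \<Rightarrow> 'g topology \<Rightarrow> ('g \<Rightarrow> 'r::comm_ring_1) set" where
  "H1 G T = {c \<in> C1 G T. \<forall>\<sigma>\<in>carrier G. \<forall>\<tau>\<in>carrier G. coboundary G c (\<sigma>, \<tau>) = 0}"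

definition Z2 :: "'g monoid \<Rightarrow> 'g topology \<Rightarrow> ('g \<times> 'g \<Rightarrow> 'r::comm_ring_1) monoid" where
  "Z2 G T =
     \<lparr>carrier = {c \<in> C2 G T. \<forall>\<sigma>\<in>carrier G. \<forall>\<tau>\<in>carrier G. \<forall>\<rho>\<in>carrier G.
        c (\<tau>, \<rho>) - c (\<sigma> \<otimes>\<^bsub>G\<^esub> \<tau>, \<rho>) + c (\<sigma>, \<tau> \<otimes>\<^bsub>G\<^esub> \<rho>) - c (\<sigma>, \<tau>) = 0},
      Group.monoid.mult = (\<lambda>c c'. \<lambda>p\<in>carrier G \<times> carrier G. c p + c' p),
      Group.monoid.one = (\<lambda>p\<in>carrier G \<times> carrier G. 0)\<rparr>"

definition B2 :: "'g monoid \<Rightarrow> 'g topology \<Rightarrow> ('g \<times> 'g \<Rightarrow> 'r::comm_ring_1) set" where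
  "B2 G T = coboundary G ` C1 G T"

definition H2 :: "'g monoid \<Rightarrow> 'g topology \<Rightarrow> ('g \<times> 'g \<Rightarrow> 'r::comm_ring_1) set monoid" where
  "H2 G T = Z2 G T Mod B2 G T"

definition H2_class ::
  "'g monoid \<Rightarrow> 'g topology \<Rightarrow> ('g \<times> 'g \<Rightarrow> 'r::comm_ring_1) \<Rightarrow> ('g \<times> 'g \<Rightarrow> 'r) set" where
  "H2_class G T c = B2 G T #>\<^bsub>Z2 G T\<^esub> c"

definition massey_tilde ::
  "'g monoid \<Rightarrow> (nat \<Rightarrow> nat \<Rightarrow> 'g \<Rightarrow> 'r::comm_ring_1) \<Rightarrow> nat \<Rightarrow> nat \<Rightarrow> 'g \<times> 'g \<Rightarrow> 'r" where
  "massey_tilde G c i j =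
     (\<lambda>p\<in>carrier G \<times> carrier G. - (\<Sum>r = i..<j. cup G (c i r) (c (r + 1) j) p))"

definition defining_system ::
  "'g monoid \<Rightarrow> 'g topology \<Rightarrow> nat \<Rightarrow> (nat \<Rightarrow> nat \<Rightarrow> 'g \<Rightarrow> 'r::comm_ring_1) \<Rightarrow> bool" where
  "defining_system G T n c \<longleftrightarrow>
     (\<forall>i j. 1 \<le> i \<and> i \<le> j \<and> j \<le> n \<and> (i, j) \<noteq> (1, n) \<longrightarrow>
        c i j \<in> C1 G T \<and> coboundary G (c i j) = massey_tilde G c i j)"


section \<open>Transgression and the pairing\<close>

text \<open>\<open>H1_invariant S T N\<close> is \<open>H^1(N)^S\<close>.\<close>

definition H1_invariant :: "'s monoid \<Rightarrow> 's topology \<Rightarrow> 's set \<Rightarrow> ('s \<Rightarrow> 'r::comm_ring_1) set" where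
  "H1_invariant S T N =
     {f \<in> H1 (S\<lparr>carrier := N\<rparr>) (subtopology T N).
        \<forall>\<sigma>\<in>carrier S. \<forall>\<nu>\<in>N. f (inv\<^bsub>S\<^esub> \<sigma> \<otimes>\<^bsub>S\<^esub> \<nu> \<otimes>\<^bsub>S\<^esub> \<sigma>) = f \<nu>}"

text \<open>
  The usual cochain description of the transgression: \<open>f\<close> extends to a continuous cochain \<open>y\<close> on
  \<open>S\<close> whose coboundary is the inflation of a 2-cocycle \<open>b\<close> of \<open>S/N\<close>, and \<open>trg f = [b]\<close>.
\<close>

definition trg ::
  "'s monoid \<Rightarrow> 's topology \<Rightarrow> 's set \<Rightarrow> ('s \<Rightarrow> 'r::comm_ring_1) \<Rightarrow> ('s set \<times> 's set \<Rightarrow> 'r) set" where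
  "trg S T N f = (THE \<alpha>. \<exists>y \<in> C1 S T. \<exists>b \<in> carrier (Z2 (S Mod N) (quotient_topology S T N)).
     restrict y N = f \<and>
     (\<forall>\<sigma>\<in>carrier S. \<forall>\<tau>\<in>carrier S. coboundary S y (\<sigma>, \<tau>) = b (N #>\<^bsub>S\<^esub> \<sigma>, N #>\<^bsub>S\<^esub> \<tau>)) \<and>
     \<alpha> = H2_class (S Mod N) (quotient_topology S T N) b)"

text \<open>
  The pairing \<open>N/N^m[S,N] \<times> H^2(S/N) \<rightarrow> \<int>/m\<close>, for coefficients \<open>\<int>/m\<close>.  Its first argument \<open>K\<close> is
  a coset of \<open>N^m[S,N]\<close> in \<open>N\<close>; \<^const>\<open>The\<close> picks the common value of \<open>trg^{-1}(\<alpha>)\<close> on \<open>K\<close>.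
\<close>

definition trg_pairing ::
  "'s monoid \<Rightarrow> 's topology \<Rightarrow> 's set \<Rightarrow> 's set \<Rightarrow> ('s set \<times> 's set \<Rightarrow> 'r::comm_ring_1) set \<Rightarrow> 'r" where
  "trg_pairing S T N K \<alpha> =
     (THE z. \<forall>\<sigma>\<in>K. the_inv_into (H1_invariant S T N) (trg S T N) \<alpha> \<sigma> = z)"

end

theory Submission
  imports Defs
begin

text \<open>
  A defining system is a unitriangular representation of \<open>S/N\<close> of size \<open>n + 1\<close> with its corner entry
  missing.  Since \<open>S\<close> is free, its inflation to \<open>S\<close> is completed by a corner entry \<open>y\<close>, which is a
  linear combination of Magnus coefficients: the representation \<open>\<rho>\<close> extends to the ring of power
  series, whence \<open>\<rho> \<sigma>\<close> is the sum over all words \<open>u\<close> of \<open>\<epsilon> u \<sigma>\<close> times the product of the matrices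
  \<open>\<rho> (\<iota> a) - 1\<close>, \<open>a\<close> in \<open>u\<close>.  On \<open>N\<close> only words of length \<open>n\<close> contribute, their products of
  superdiagonal entries are 0 or 1, and \<open>y\<close> restricts to the coefficient of \<open>w\<close>.  The coboundary of
  \<open>y\<close> is the inflation of the Massey cochain, so its class is the transgression of \<open>y\<close> restricted to
  \<open>N\<close>.  The transgression is injective because continuous homomorphisms from \<open>S\<close> to the
  coefficients are combinations of the coefficients of words of length 1, which vanish on \<open>N\<close>.
\<close>

text \<open>With the signs chosen in \<open>coboundary\<close> and \<open>massey_tilde\<close>, the
  equations of a defining system say that each entry at a product is the sum of the two entries plus
  the products of intermediate entries. This is matrix multiplication without signs, so the pairing
  yields the coefficient of \<open>w\<close> itself and not its negative. The universal property is
  spent on the Magnus map alone; representations of \<open>S\<close> are then obtained by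
  substituting nilpotent matrices for the variables. The basis may be infinite, and its convergence
  to 1 is what leaves finitely many relevant letters and makes the substitution a finite sum. Two
  definite descriptions shape the rest. \<open>trg\<close> is determined at \<open>f\<close> only if
  \<open>f\<close> extends to a cochain whose coboundary comes from \<open>S/N\<close>, and
  \<open>the_inv_into\<close> is determined only if \<open>trg\<close> is injective on all of
  H^1(N)^S. Exhibiting \<open>y\<close> is therefore not enough: every invariant homomorphism must
  be extended continuously, which brings in open subgroups and coset representatives.\<close>

section \<open>Continuity of maps into discrete spaces\<close>

text \<open>A product of two discrete spaces is discrete, so every binary operation \<open>F\<close>
  on it is continuous.\<close>

lemma continuous_map_discrete_comp2:
  assumes "continuous_map Z (discrete_topology UNIV) f" "continuous_map Z (discrete_topology UNIV) g"
  shows "continuous_map Z (discrete_topology UNIV) (\<lambda>x. F (f x) (g x))"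
proof -
  have "continuous_map Z (prod_topology (discrete_topology UNIV) (discrete_topology UNIV)) (\<lambda>x. (f x, g x))"
    using assms by (simp add: continuous_map_paired)
  then have "continuous_map Z (discrete_topology UNIV) (\<lambda>x. (f x, g x))"
    by (simp flip: prod_topology_discrete_topology)
  then have "continuous_map Z (discrete_topology UNIV) ((\<lambda>(a, b). F a b) \<circ> (\<lambda>x. (f x, g x)))"
    by (rule continuous_map_compose) simp
  then show ?thesis
    by (simp add: o_def)
qed

lemma continuous_map_discrete_comp:
  assumes "continuous_map Z (discrete_topology UNIV) f"
  shows "continuous_map Z (discrete_topology UNIV) (\<lambda>x. F (f x))"
  using continuous_map_discrete_comp2[OF assms assms, of "\<lambda>x y. F x"] .

lemma continuous_map_discrete_arith:
  fixes f g :: "'x \<Rightarrow> 'r::comm_ring_1"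
  assumes "continuous_map Z (discrete_topology UNIV) f" "continuous_map Z (discrete_topology UNIV) g"
  shows "continuous_map Z (discrete_topology UNIV) (\<lambda>x. f x + g x)"
    and "continuous_map Z (discrete_topology UNIV) (\<lambda>x. f x - g x)"
    and "continuous_map Z (discrete_topology UNIV) (\<lambda>x. f x * g x)"
  using assms by (rule continuous_map_discrete_comp2)+

lemma continuous_map_discrete_sum:
  fixes f :: "'i \<Rightarrow> 'x \<Rightarrow> 'b::comm_monoid_add"
  assumes "finite I" "\<And>i. i \<in> I \<Longrightarrow> continuous_map Z (discrete_topology UNIV) (f i)"
  shows "continuous_map Z (discrete_topology UNIV) (\<lambda>x. \<Sum>i\<in>I. f i x)"
  using assms by induction (auto intro: continuous_map_discrete_comp2[where F = "(+)"])

section \<open>Convolution of functions on words\<close>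

text \<open>The product of series, taken on all words instead of extensionally on
  \<open>lists A\<close>. Its laws are then equations between functions without side conditions, and
  \<open>conv_cong_lists\<close> transfers them to \<open>power_series A\<close>.\<close>

definition conv :: "('a list \<Rightarrow> 'r::comm_ring_1) \<Rightarrow> ('a list \<Rightarrow> 'r) \<Rightarrow> 'a list \<Rightarrow> 'r" where
  "conv f g w = (\<Sum>k\<le>length w. f (take k w) * g (drop k w))"

definition delta :: "'a list \<Rightarrow> 'r::comm_ring_1" where
  "delta w = (if w = [] then 1 else 0)"

lemma conv_Nil [simp]: "conv f g [] = f [] * g []"
  by (simp add: conv_def)

lemma conv_Cons: "conv f g (a # w) = f [] * g (a # w) + conv (\<lambda>u. f (a # u)) g w"
  by (simp add: conv_def sum.atMost_Suc_shift del: sum.atMost_Suc)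

lemma conv_add_left: "conv (\<lambda>u. f u + f' u) g w = conv f g w + conv f' g w"
  by (simp add: conv_def distrib_right sum.distrib)

lemma conv_scale_left: "conv (\<lambda>u. c * f u) g w = c * conv f g w"
  by (simp add: conv_def sum_distrib_left mult.assoc)

text \<open>\<open>conv_Cons\<close> splits off the first letter and leaves a convolution of the
  shifted series \<open>\<lambda>u. f (a # u)\<close> at a shorter word. Hence the induction on the
  word with \<open>f\<close> arbitrary.\<close>

lemma conv_assoc: "conv (conv f g) h = conv f (conv g h)"
proof
  show "conv (conv f g) h w = conv f (conv g h) w" for w
  proof (induction w arbitrary: f)
    case (Cons a w)
    have "conv (conv f g) h (a # w) =
        f [] * (g [] * h (a # w) + conv (\<lambda>u. g (a # u)) h w) + conv (conv (\<lambda>u. f (a # u)) g) h w"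
      by (simp add: conv_Cons conv_add_left conv_scale_left algebra_simps)
    then show ?case
      by (simp add: Cons.IH conv_Cons)
  qed (simp add: mult.assoc)
qed

lemma conv_zero_left: "conv (\<lambda>u. 0) f w = 0"
  by (simp add: conv_def)

lemma conv_delta_left: "conv delta f = f"
proof
  show "conv delta f w = f w" for w
    by (cases w) (simp_all add: conv_Cons conv_zero_left delta_def)
qed

lemma conv_delta_right: "conv f delta = f"
proof
  show "conv f delta w = f w" for w
    by (induction w arbitrary: f) (simp_all add: conv_Cons delta_def)
qed

lemma take_drop_in_lists: "w \<in> lists A \<Longrightarrow> take k w \<in> lists A \<and> drop k w \<in> lists A"
  using set_take_subset set_drop_subset by (fastforce simp: in_lists_conv_set)

lemma conv_cong_lists:
  assumes "w \<in> lists A" "\<And>u. u \<in> lists A \<Longrightarrow> f u = f' u" "\<And>u. u \<in> lists A \<Longrightarrow> g u = g' u"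
  shows "conv f g w = conv f' g' w"
  unfolding conv_def using assms take_drop_in_lists[OF assms(1)] by (intro sum.cong) auto

text \<open>Solves \<open>conv f (rinv f) = delta\<close> for the coefficient at
  \<open>a # w\<close>, with the constant term of \<open>f\<close> read as 1; the recursion descends
  to the suffixes \<open>drop k w\<close>.\<close>

fun rinv :: "('a list \<Rightarrow> 'r::comm_ring_1) \<Rightarrow> 'a list \<Rightarrow> 'r" where
  "rinv f [] = 1"
| "rinv f (a # w) = - (\<Sum>k\<le>length w. f (a # take k w) * rinv f (drop k w))"

lemma conv_rinv:
  assumes "f [] = 1"
  shows "conv f (rinv f) = delta"
proof
  show "conv f (rinv f) w = delta w" for w
    using assms by (cases w) (simp_all add: conv_Cons delta_def, simp add: conv_def)
qed

text \<open>\<open>rinv f\<close> always has constant term 1, so it has a right inverse as well;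
  having \<open>f\<close> as a left inverse, it forces the two to coincide.\<close>

lemma rinv_conv:
  assumes "f [] = 1"
  shows "conv (rinv f) f = delta"
proof -
  have f: "conv f (rinv f) = delta" and g: "conv (rinv f) (rinv (rinv f)) = delta"
    using assms by (simp_all add: conv_rinv)
  have "f = conv f (conv (rinv f) (rinv (rinv f)))"
    by (simp add: g conv_delta_right)
  also have "\<dots> = rinv (rinv f)"
    by (simp add: f conv_delta_left flip: conv_assoc)
  finally show ?thesis
    using g by simp
qed

section \<open>The Magnus group\<close>

text \<open>The series with constant term 1 form a closed set containing the images of the basis,
  and their inverses are given by a recursion from which continuity can be read off. This is the
  profinite target to which the universal property is applied, in place of the full unit
  group.\<close>

definition magnus_group :: "'a set \<Rightarrow> ('a list \<Rightarrow> 'r::comm_ring_1) monoid" where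
  "magnus_group A =
     \<lparr>carrier = {f \<in> lists A \<rightarrow>\<^sub>E UNIV. f [] = 1},
      Group.monoid.mult = Group.monoid.mult (power_series A),
      Group.monoid.one = Group.monoid.one (power_series A)\<rparr>"

definition magnus_topology :: "'a set \<Rightarrow> ('a list \<Rightarrow> 'r::comm_ring_1) topology" where
  "magnus_topology A = subtopology (power_series_topology A) (carrier (magnus_group A))"

lemma mult_power_series:
  "f \<otimes>\<^bsub>power_series A\<^esub> g = restrict (conv f g) (lists A)"
  by (simp add: power_series_def conv_def fun_eq_iff restrict_def)

lemma one_power_series: "\<one>\<^bsub>power_series A\<^esub> = restrict delta (lists A)"
  by (simp add: power_series_def delta_def fun_eq_iff restrict_def)

lemma carrier_power_series: "carrier (power_series A) = lists A \<rightarrow>\<^sub>E UNIV"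
  by (simp add: power_series_def)

lemma monoid_power_series: "Group.monoid (power_series A)"
proof
  fix f g h :: "'a list \<Rightarrow> 'r::comm_ring_1"
  assume f: "f \<in> carrier (power_series A)" and h: "h \<in> carrier (power_series A)"
  have "conv (restrict (conv f g) (lists A)) h w = conv f (restrict (conv g h) (lists A)) w"
    if w: "w \<in> lists A" for w
  proof -
    have "conv (restrict (conv f g) (lists A)) h w = conv (conv f g) h w"
      using w by (intro conv_cong_lists) auto
    also have "\<dots> = conv f (conv g h) w"
      by (simp add: conv_assoc)
    also have "\<dots> = conv f (restrict (conv g h) (lists A)) w"
      using w by (intro conv_cong_lists) auto
    finally show ?thesis .
  qed
  then show "f \<otimes>\<^bsub>power_series A\<^esub> g \<otimes>\<^bsub>power_series A\<^esub> h = f \<otimes>\<^bsub>power_series A\<^esub> (g \<otimes>\<^bsub>power_series A\<^esub> h)"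
    unfolding mult_power_series by (rule restrict_ext)
  have "conv (restrict delta (lists A)) f w = f w \<and> conv f (restrict delta (lists A)) w = f w"
    if w: "w \<in> lists A" for w
  proof -
    have "conv (restrict delta (lists A)) f w = conv delta f w"
      "conv f (restrict delta (lists A)) w = conv f delta w"
      using w by (auto intro: conv_cong_lists)
    then show ?thesis
      by (simp add: conv_delta_left conv_delta_right)
  qed
  then have "restrict (conv (restrict delta (lists A)) f) (lists A) = restrict f (lists A)"
    "restrict (conv f (restrict delta (lists A))) (lists A) = restrict f (lists A)"
    by (auto intro: restrict_ext)
  moreover have "restrict f (lists A) = f"
    using f by (simp add: carrier_power_series PiE_restrict)
  ultimately show "\<one>\<^bsub>power_series A\<^esub> \<otimes>\<^bsub>power_series A\<^esub> f = f" "f \<otimes>\<^bsub>power_series A\<^esub> \<one>\<^bsub>power_series A\<^esub> = f"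
    unfolding mult_power_series one_power_series by simp_all
qed (auto simp: mult_power_series one_power_series carrier_power_series)

lemma rinv_in_magnus_group:
  assumes "f \<in> carrier (magnus_group A)"
  shows "restrict (rinv f) (lists A) \<in> carrier (magnus_group A)"
    and "restrict (rinv f) (lists A) \<otimes>\<^bsub>power_series A\<^esub> f = \<one>\<^bsub>power_series A\<^esub>"
    and "f \<otimes>\<^bsub>power_series A\<^esub> restrict (rinv f) (lists A) = \<one>\<^bsub>power_series A\<^esub>"
proof -
  have f: "f [] = 1"
    using assms by (simp add: magnus_group_def)
  have "conv (restrict (rinv f) (lists A)) f w = conv (rinv f) f w"
    "conv f (restrict (rinv f) (lists A)) w = conv f (rinv f) w" if "w \<in> lists A" for w
    using that by (auto intro: conv_cong_lists)
  then show "restrict (rinv f) (lists A) \<otimes>\<^bsub>power_series A\<^esub> f = \<one>\<^bsub>power_series A\<^esub>"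
    "f \<otimes>\<^bsub>power_series A\<^esub> restrict (rinv f) (lists A) = \<one>\<^bsub>power_series A\<^esub>"
    using f by (auto simp: mult_power_series one_power_series fun_eq_iff rinv_conv conv_rinv)
  show "restrict (rinv f) (lists A) \<in> carrier (magnus_group A)"
    by (simp add: magnus_group_def)
qed

lemma group_magnus_group: "group (magnus_group A)"
proof (rule groupI)
  have sub: "carrier (magnus_group A) \<subseteq> carrier (power_series A)"
    by (auto simp: magnus_group_def carrier_power_series)
  show "f \<otimes>\<^bsub>magnus_group A\<^esub> g \<otimes>\<^bsub>magnus_group A\<^esub> h = f \<otimes>\<^bsub>magnus_group A\<^esub> (g \<otimes>\<^bsub>magnus_group A\<^esub> h)"
    if "f \<in> carrier (magnus_group A)" "g \<in> carrier (magnus_group A)" "h \<in> carrier (magnus_group A)" for f g h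
    using monoid.m_assoc[OF monoid_power_series, of f A g h] that sub by (auto simp: magnus_group_def)
  show "\<one>\<^bsub>magnus_group A\<^esub> \<otimes>\<^bsub>magnus_group A\<^esub> f = f" if "f \<in> carrier (magnus_group A)" for f
    using monoid.l_one[OF monoid_power_series, of f A] that sub by (auto simp: magnus_group_def)
  show "\<exists>g\<in>carrier (magnus_group A). g \<otimes>\<^bsub>magnus_group A\<^esub> f = \<one>\<^bsub>magnus_group A\<^esub>"
    if "f \<in> carrier (magnus_group A)" for f
    using rinv_in_magnus_group(1,2)[OF that]
    by (intro bexI[of _ "restrict (rinv f) (lists A)"]) (simp_all add: magnus_group_def)
qed (auto simp: magnus_group_def mult_power_series one_power_series delta_def)

lemma inv_magnus_group:
  assumes "f \<in> carrier (magnus_group A)"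
  shows "inv\<^bsub>magnus_group A\<^esub> f = restrict (rinv f) (lists A)"
  using rinv_in_magnus_group[OF assms] assms group_magnus_group
  by (intro group.inv_equality) (auto simp: magnus_group_def)

lemma magnus_group_subset_Units: "carrier (magnus_group A) \<subseteq> Units (power_series A)"
proof
  fix f :: "'a list \<Rightarrow> 'r::comm_ring_1"
  assume f: "f \<in> carrier (magnus_group A)"
  then have "f \<in> carrier (power_series A)" "restrict (rinv f) (lists A) \<in> carrier (power_series A)"
    by (auto simp: magnus_group_def carrier_power_series)
  then show "f \<in> Units (power_series A)"
    using rinv_in_magnus_group(2,3)[OF f] unfolding Units_def by blast
qed

lemma topspace_magnus_topology: "topspace (magnus_topology A) = carrier (magnus_group A)"
  by (auto simp: magnus_topology_def power_series_topology_def magnus_group_def)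

lemma continuous_map_magnus_coordinate:
  "w \<in> lists A \<Longrightarrow> continuous_map (magnus_topology A) (discrete_topology UNIV) (\<lambda>f. f w)"
  unfolding magnus_topology_def power_series_topology_def
  by (intro continuous_map_from_subtopology continuous_map_product_projection)

lemma continuous_map_into_magnus:
  assumes "\<And>x. x \<in> topspace Z \<Longrightarrow> h x \<in> carrier (magnus_group A)"
    and "\<And>w. w \<in> lists A \<Longrightarrow> continuous_map Z (discrete_topology UNIV) (\<lambda>x. h x w)"
  shows "continuous_map Z (magnus_topology A) h"
  unfolding magnus_topology_def power_series_topology_def
  using assms by (auto simp: continuous_map_in_subtopology continuous_map_componentwise magnus_group_def PiE_iff)

text \<open>Each coefficient of the inverse is a polynomial in finitely many coefficients of the
  series.\<close>

lemma continuous_map_rinv: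
  assumes "\<And>u. u \<in> lists A \<Longrightarrow> continuous_map Z (discrete_topology UNIV) (\<lambda>x. h x u)"
  shows "w \<in> lists A \<Longrightarrow> continuous_map Z (discrete_topology UNIV) (\<lambda>x. rinv (h x) w)"
proof (induction w rule: length_induct)
  case (1 w)
  show ?case
  proof (cases w)
    case (Cons a v)
    have "continuous_map Z (discrete_topology UNIV) (\<lambda>x. rinv (h x) (drop k v))" for k
      using 1 Cons take_drop_in_lists[of v A k] by auto
    moreover have "continuous_map Z (discrete_topology UNIV) (\<lambda>x. h x (a # take k v))" for k
      using 1 Cons take_drop_in_lists[of v A k] by (intro assms) auto
    ultimately have "continuous_map Z (discrete_topology UNIV)
        (\<lambda>x. \<Sum>k\<le>length v. h x (a # take k v) * rinv (h x) (drop k v))"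
      by (intro continuous_map_discrete_sum continuous_map_discrete_arith) auto
    then show ?thesis
      unfolding Cons rinv.simps by (rule continuous_map_discrete_comp[where F = uminus])
  qed simp
qed

text \<open>Compactness is Tychonoff's theorem for finite coefficient spaces, together with
  closedness of the condition on the constant term. Connected sets are points because every
  coordinate maps them into a discrete space.\<close>

lemma profinite_magnus_group:
  "profinite_group (magnus_group A :: ('a list \<Rightarrow> 'r::{finite,comm_ring_1}) monoid) (magnus_topology A)"
proof (intro profinite_group.intro profinite_group_axioms.intro group_magnus_group topspace_magnus_topology)
  let ?G = "magnus_group A :: ('a list \<Rightarrow> 'r) monoid" and ?T = "magnus_topology A :: ('a list \<Rightarrow> 'r) topology"
  let ?P = "power_series_topology A :: ('a list \<Rightarrow> 'r) topology"
  have coord: "continuous_map (prod_topology ?T ?T) (discrete_topology UNIV) (\<lambda>p. fst p w)"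
    "continuous_map (prod_topology ?T ?T) (discrete_topology UNIV) (\<lambda>p. snd p w)" if "w \<in> lists A" for w
    using continuous_map_compose[OF continuous_map_fst continuous_map_magnus_coordinate[OF that]]
      continuous_map_compose[OF continuous_map_snd continuous_map_magnus_coordinate[OF that]]
    by (auto simp: o_def)
  have "continuous_map (prod_topology ?T ?T) ?T (\<lambda>p. fst p \<otimes>\<^bsub>?G\<^esub> snd p)"
  proof (rule continuous_map_into_magnus)
    fix p assume "p \<in> topspace (prod_topology ?T ?T)"
    then show "fst p \<otimes>\<^bsub>?G\<^esub> snd p \<in> carrier ?G"
      by (auto simp: topspace_magnus_topology intro: monoid.m_closed[OF group.is_monoid[OF group_magnus_group]])
  next
    fix w :: "'a list" assume w: "w \<in> lists A"
    then have "continuous_map (prod_topology ?T ?T) (discrete_topology UNIV) (\<lambda>p. conv (fst p) (snd p) w)"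
      unfolding conv_def using take_drop_in_lists[OF w]
      by (intro continuous_map_discrete_sum continuous_map_discrete_arith coord) auto
    then show "continuous_map (prod_topology ?T ?T) (discrete_topology UNIV) (\<lambda>p. (fst p \<otimes>\<^bsub>?G\<^esub> snd p) w)"
      using w by (simp add: magnus_group_def mult_power_series)
  qed
  then show "continuous_map (prod_topology ?T ?T) ?T (\<lambda>(f, g). f \<otimes>\<^bsub>?G\<^esub> g)"
    by (simp add: case_prod_unfold)
  show "continuous_map ?T ?T (\<lambda>f. inv\<^bsub>?G\<^esub> f)"
  proof (rule continuous_map_into_magnus)
    fix w :: "'a list" assume w: "w \<in> lists A"
    have "continuous_map ?T (discrete_topology UNIV) (\<lambda>f. rinv f w)"
      by (rule continuous_map_rinv[OF continuous_map_magnus_coordinate w])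
    moreover have "(inv\<^bsub>?G\<^esub> f) w = rinv f w" if "f \<in> topspace ?T" for f
      using that w by (simp add: topspace_magnus_topology inv_magnus_group)
    ultimately show "continuous_map ?T (discrete_topology UNIV) (\<lambda>f. (inv\<^bsub>?G\<^esub> f) w)"
      by (metis (no_types, lifting) continuous_map_eq)
  qed (simp add: topspace_magnus_topology group.inv_closed group_magnus_group)
  have "continuous_map ?P (discrete_topology UNIV) (\<lambda>f. f [])"
    unfolding power_series_topology_def by (intro continuous_map_product_projection) auto
  then have "closedin ?P {f \<in> topspace ?P. f [] \<in> {1}}"
    by (rule closedin_continuous_map_preimage) auto
  also have "{f \<in> topspace ?P. f [] \<in> {1}} = carrier ?G"
    by (auto simp: power_series_topology_def magnus_group_def)
  moreover have "compact_space ?P"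
    by (simp add: power_series_topology_def compact_space_product_topology compact_space_discrete_topology)
  ultimately show "compact_space ?T"
    unfolding magnus_topology_def by (simp add: closedin_compact_space compact_space_subtopology)
  show "Hausdorff_space ?T"
    by (simp add: magnus_topology_def power_series_topology_def Hausdorff_space_product_topology
        Hausdorff_space_subtopology)
  show "\<exists>x. C \<subseteq> {x}" if C: "connectedin ?T C" for C
  proof -
    have "f = g" if "f \<in> C" "g \<in> C" for f g
    proof -
      have fg: "f \<in> carrier ?G" "g \<in> carrier ?G"
        using that C connectedin_subset_topspace topspace_magnus_topology by blast+
      have "f w = g w" if "w \<in> lists A" for w
      proof -
        have "connectedin (discrete_topology UNIV) ((\<lambda>f. f w) ` C)"
          by (rule connectedin_continuous_map_image[OF continuous_map_magnus_coordinate[OF that] C])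
        then show ?thesis
          using \<open>f \<in> C\<close> \<open>g \<in> C\<close> by (auto simp: connectedin_discrete_topology)
      qed
      then show ?thesis
        using fg by (intro PiE_ext[of f "lists A" "\<lambda>_. UNIV"]) (auto simp: magnus_group_def)
    qed
    then show ?thesis by blast
  qed
qed

section \<open>Maps out of the free profinite group\<close>

text \<open>
  The universal property only speaks of groups with carrier in one fixed type; other targets are
  transported to that type along an injection.
\<close>

definition transported_group :: "'g monoid \<Rightarrow> ('g \<Rightarrow> 'h) \<Rightarrow> 'h monoid" where
  "transported_group G e =
     \<lparr>carrier = e ` carrier G,
      Group.monoid.mult = (\<lambda>x y. e (inv_into (carrier G) e x \<otimes>\<^bsub>G\<^esub> inv_into (carrier G) e y)),
      Group.monoid.one = e \<one>\<^bsub>G\<^esub>\<rparr>"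

definition transported_topology :: "'g monoid \<Rightarrow> 'g topology \<Rightarrow> ('g \<Rightarrow> 'h) \<Rightarrow> 'h topology" where
  "transported_topology G U e = pullback_topology (e ` carrier G) (inv_into (carrier G) e) U"

context
  fixes G :: "'g monoid" and U :: "'g topology" and e :: "'g \<Rightarrow> 'h"
  assumes profinite: "profinite_group G U" and inj: "inj_on e (carrier G)"
begin

interpretation profinite_group G U by (rule profinite)

abbreviation "unembed \<equiv> inv_into (carrier G) e"

lemma unembed_embed: "x \<in> carrier G \<Longrightarrow> unembed (e x) = x"
  using inj by (rule inv_into_f_f)

lemma homeomorphic_maps_transported: "homeomorphic_maps U (transported_topology G U e) e unembed"
proof -
  have "continuous_map U U (unembed \<circ> e)"
    using unembed_embed by (intro continuous_map_eq[OF continuous_map_id]) (simp add: topspace_eq)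
  then have "continuous_map U (transported_topology G U e) e"
    unfolding transported_topology_def by (intro continuous_map_pullback') (auto simp: topspace_eq)
  moreover have "continuous_map (transported_topology G U e) U unembed"
    using continuous_map_pullback[OF continuous_map_id] unfolding transported_topology_def
    by (metis id_comp)
  ultimately show ?thesis
    using unembed_embed by (auto simp: homeomorphic_maps_def topspace_eq transported_topology_def topspace_pullback_topology)
qed

lemma profinite_transported: "profinite_group (transported_group G e) (transported_topology G U e)"
proof -
  let ?G = "transported_group G e" and ?U = "transported_topology G U e"
  have car: "carrier ?G = e ` carrier G"
    by (simp add: transported_group_def)
  have e: "continuous_map U ?U e" and unembed: "continuous_map ?U U unembed"
    using homeomorphic_maps_transported by (auto simp: homeomorphic_maps_def)
  have top: "topspace ?U = carrier ?G"
    using unembed_embed by (auto simp: car transported_topology_def topspace_pullback_topology topspace_eq)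
  have homeo: "U homeomorphic_space ?U"
    using homeomorphic_maps_transported by (auto simp: homeomorphic_space_def)
  have grp: "group ?G"
  proof (rule groupI)
    show "\<exists>y\<in>carrier ?G. y \<otimes>\<^bsub>?G\<^esub> x = \<one>\<^bsub>?G\<^esub>" if "x \<in> carrier ?G" for x
      using that by (auto simp: transported_group_def unembed_embed intro!: bexI[of _ "inv\<^bsub>G\<^esub> _"])
  qed (auto simp: transported_group_def unembed_embed m_assoc)
  have invG: "inv\<^bsub>?G\<^esub> x = e (inv\<^bsub>G\<^esub> unembed x)" if "x \<in> carrier ?G" for x
    using that by (intro group.inv_equality[OF grp]) (auto simp: transported_group_def unembed_embed)
  show ?thesis
  proof (intro profinite_group.intro profinite_group_axioms.intro grp top)
    have "continuous_map (prod_topology ?U ?U) (prod_topology U U) (\<lambda>p. (unembed (fst p), unembed (snd p)))"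
      using continuous_map_compose[OF continuous_map_fst unembed, of ?U] continuous_map_compose[OF continuous_map_snd unembed, of ?U]
      by (simp add: continuous_map_paired o_def)
    then have "continuous_map (prod_topology ?U ?U) ?U
        (e \<circ> ((\<lambda>(x, y). x \<otimes>\<^bsub>G\<^esub> y) \<circ> (\<lambda>p. (unembed (fst p), unembed (snd p)))))"
      by (rule continuous_map_compose[OF continuous_map_compose[OF _ continuous_mult] e])
    then show "continuous_map (prod_topology ?U ?U) ?U (\<lambda>(x, y). x \<otimes>\<^bsub>?G\<^esub> y)"
      by (simp add: o_def case_prod_unfold transported_group_def)
    have "continuous_map ?U ?U (e \<circ> ((\<lambda>x. inv\<^bsub>G\<^esub> x) \<circ> unembed))"
      by (rule continuous_map_compose[OF continuous_map_compose[OF unembed continuous_inv] e])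
    then show "continuous_map ?U ?U (\<lambda>x. inv\<^bsub>?G\<^esub> x)"
      by (rule continuous_map_eq) (simp add: top invG)
    show "compact_space ?U" "Hausdorff_space ?U"
      using homeo compact Hausdorff homeomorphic_compact_space homeomorphic_Hausdorff_space by blast+
    show "\<exists>x. C \<subseteq> {x}" if C: "connectedin ?U C" for C
    proof -
      have "connectedin U (unembed ` C)"
        using connectedin_continuous_map_image[OF unembed C] .
      then obtain x where x: "unembed ` C \<subseteq> {x}"
        using totally_disconnected by blast
      have "C \<subseteq> e ` carrier G"
        using connectedin_subset_topspace[OF C] top car by simp
      have "y = e x" if "y \<in> C" for y
      proof -
        have "e (unembed y) = y"
          using \<open>C \<subseteq> e ` carrier G\<close> that by (intro f_inv_into_f) blast
        then show ?thesis
          using x that by (metis imageI singletonD subsetD)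
      qed
      then show ?thesis by blast
    qed
  qed
qed

end

context free_profinite_group
begin

lemma \<iota>_closed: "a \<in> A \<Longrightarrow> \<iota> a \<in> carrier S"
  using basis_converges by (auto simp: converges_to_one_def)

lemma universal_embedded:
  fixes G :: "'g monoid" and e :: "'g \<Rightarrow> ('a list \<times> nat) set"
  assumes G: "profinite_group G U" and e: "inj_on e (carrier G)" and \<phi>: "converges_to_one A G U \<phi>"
  obtains h where "h \<in> continuous_hom S T G U" "\<And>a. a \<in> A \<Longrightarrow> h (\<iota> a) = \<phi> a"
proof -
  let ?G = "transported_group G e" and ?U = "transported_topology G U e"
  let ?d = "inv_into (carrier G) e"
  have cont: "continuous_map U ?U e" "continuous_map ?U U ?d"
    using homeomorphic_maps_transported[OF G e] by (auto simp: homeomorphic_maps_def)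
  have \<phi>_closed: "\<phi> a \<in> carrier G" if "a \<in> A" for a
    using \<phi> that by (auto simp: converges_to_one_def)
  have topU: "topspace U = carrier G"
    by (rule profinite_group.topspace_eq[OF G])
  have "converges_to_one A ?G ?U (\<lambda>a. e (\<phi> a))"
    unfolding converges_to_one_def
  proof (intro conjI allI impI)
    show "(\<lambda>a. e (\<phi> a)) \<in> A \<rightarrow> carrier ?G"
      using \<phi>_closed by (auto simp: transported_group_def)
    fix V assume V: "openin ?U V \<and> \<one>\<^bsub>?G\<^esub> \<in> V"
    have "openin U {x \<in> topspace U. e x \<in> V}"
      using V cont(1) by (auto intro: openin_continuous_map_preimage)
    moreover have "\<one>\<^bsub>G\<^esub> \<in> carrier G"
      using G by (simp add: profinite_group_def group.is_monoid)
    ultimately have "finite {a \<in> A. \<phi> a \<notin> {x \<in> topspace U. e x \<in> V}}"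
      using V \<phi> topU by (auto simp: converges_to_one_def transported_group_def)
    then show "finite {a \<in> A. e (\<phi> a) \<notin> V}"
      by (rule rev_finite_subset) auto
  qed
  from universal[OF profinite_transported[OF G e] this] obtain h
    where h: "h \<in> continuous_hom S T ?G ?U" and ha: "\<And>a. a \<in> A \<Longrightarrow> h (\<iota> a) = e (\<phi> a)"
    by blast
  let ?h = "restrict (?d \<circ> h) (carrier S)"
  have hc: "h x \<in> e ` carrier G" if "x \<in> carrier S" for x
    using h that by (auto simp: continuous_hom_def hom_def transported_group_def)
  have hm: "h (x \<otimes> y) = e (?d (h x) \<otimes>\<^bsub>G\<^esub> ?d (h y))" if "x \<in> carrier S" "y \<in> carrier S" for x y
    using h that by (auto simp: continuous_hom_def hom_def transported_group_def)
  have closed: "?d (h x) \<in> carrier G" if "x \<in> carrier S" for x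
    using hc[OF that] inv_into_into[of _ e "carrier G"] by blast
  have "Group.monoid G"
    using G by (simp add: profinite_group_def group.is_monoid)
  then have "?d (h (x \<otimes> y)) = ?d (h x) \<otimes>\<^bsub>G\<^esub> ?d (h y)" if "x \<in> carrier S" "y \<in> carrier S" for x y
    unfolding hm[OF that] by (intro unembed_embed[OF G e] monoid.m_closed closed that)
  then have "?h \<in> hom S G"
    using closed by (intro homI) auto
  moreover have "continuous_map T U ?h"
  proof (rule continuous_map_eq)
    show "continuous_map T U (?d \<circ> h)"
      using h cont(2) by (intro continuous_map_compose) (simp_all add: continuous_hom_def)
  qed (simp add: topspace_eq)
  ultimately have "?h \<in> continuous_hom S T G U"
    by (simp add: continuous_hom_def)
  moreover have "?h (\<iota> a) = \<phi> a" if "a \<in> A" for a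
    using that ha[OF that] unembed_embed[OF G e \<phi>_closed[OF that]] \<iota>_closed by simp
  ultimately show ?thesis
    by (rule that)
qed

text \<open>Topological generation as an induction principle; it is applied to the set where two
  homomorphisms agree and to the zero set of an additive map.\<close>

lemma closed_subgroup_eq_carrier:
  assumes "closedin T D" "\<one> \<in> D" "\<And>a. a \<in> A \<Longrightarrow> \<iota> a \<in> D"
    and mult: "\<And>x y. x \<in> D \<Longrightarrow> y \<in> D \<Longrightarrow> x \<otimes> y \<in> D" and inv: "\<And>x. x \<in> D \<Longrightarrow> inv x \<in> D"
  shows "D = carrier S"
proof
  have "x \<in> D" if "x \<in> generate S (\<iota> ` A)" for x
    using that assms by induction auto
  then show "carrier S \<subseteq> D"
    using assms(1) closure_of_minimal[of "generate S (\<iota> ` A)" D T] basis_generates by auto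
  show "D \<subseteq> carrier S"
    using closedin_subset[OF assms(1)] topspace_eq by simp
qed

lemma continuous_hom_unique:
  assumes H: "group H" "Hausdorff_space U"
    and h: "h \<in> continuous_hom S T H U" and h': "h' \<in> continuous_hom S T H U"
    and eq: "\<And>a. a \<in> A \<Longrightarrow> h (\<iota> a) = h' (\<iota> a)"
  shows "h = h'"
proof -
  interpret h: group_hom S H h
    using h H(1) by (simp add: group_hom_def group_hom_axioms_def continuous_hom_def group_axioms)
  interpret h': group_hom S H h'
    using h' H(1) by (simp add: group_hom_def group_hom_axioms_def continuous_hom_def group_axioms)
  have "{x \<in> topspace T. h x = h' x} = carrier S"
  proof (rule closed_subgroup_eq_carrier)
    show "closedin T {x \<in> topspace T. h x = h' x}"
      using h h' H(2) by (intro closedin_continuous_maps_eq) (auto simp: continuous_hom_def)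
  qed (auto simp: topspace_eq eq \<iota>_closed)
  then have "h x = h' x" if "x \<in> carrier S" for x
    using that by blast
  then show ?thesis
    using h h' by (auto simp: continuous_hom_def intro: extensionalityI)
qed

text \<open>Stated for \<open>+\<close> on the coefficients, which spares turning their additive
  group into a \<open>monoid\<close> with a topology. The zero set is closed because the target is
  discrete.\<close>

lemma additive_eq_zero:
  fixes f :: "'s \<Rightarrow> 'r::comm_ring_1"
  assumes cont: "continuous_map T (discrete_topology UNIV) f"
    and add: "\<And>x y. x \<in> carrier S \<Longrightarrow> y \<in> carrier S \<Longrightarrow> f (x \<otimes> y) = f x + f y"
    and zero: "\<And>a. a \<in> A \<Longrightarrow> f (\<iota> a) = 0" and x: "x \<in> carrier S"
  shows "f x = 0"
proof -
  have one: "f \<one> = 0"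
    using add[of \<one> \<one>] by simp
  have "{x \<in> topspace T. f x \<in> {0}} = carrier S"
  proof (rule closed_subgroup_eq_carrier)
    show "closedin T {x \<in> topspace T. f x \<in> {0}}"
      by (rule closedin_continuous_map_preimage[OF cont]) simp
    show "inv x \<in> {x \<in> topspace T. f x \<in> {0}}" if "x \<in> {x \<in> topspace T. f x \<in> {0}}" for x
      using that add[of x "inv x"] one by (simp add: topspace_eq)
  qed (auto simp: topspace_eq one zero add \<iota>_closed)
  then show ?thesis
    using x by blast
qed

section \<open>Existence and uniqueness of the Magnus homomorphism\<close>

text \<open>A basic neighbourhood of 1 constrains finitely many words, and 1 + X_a differs from 1
  only at \<open>[a]\<close>. So \<open>a\<close> can be exceptional only as the head of a
  constrained word.\<close>

lemma converges_to_one_magnus: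
  "converges_to_one A (magnus_group A) (magnus_topology A)
     (\<lambda>a. \<one>\<^bsub>power_series A\<^esub> \<oplus>\<^bsub>power_series A\<^esub> series_var A a :: 'a list \<Rightarrow> 'r::comm_ring_1)"
  (is "converges_to_one A ?G ?U ?\<phi>")
  unfolding converges_to_one_def
proof (intro conjI allI impI)
  show "?\<phi> \<in> A \<rightarrow> carrier ?G"
    by (auto simp: power_series_def series_var_def magnus_group_def)
  fix V :: "('a list \<Rightarrow> 'r) set"
  assume "openin ?U V \<and> \<one>\<^bsub>?G\<^esub> \<in> V"
  then obtain W where W: "openin (power_series_topology A) W" "V = W \<inter> carrier ?G"
      and one: "\<one>\<^bsub>power_series A\<^esub> \<in> W"
    by (auto simp: magnus_topology_def openin_subtopology magnus_group_def)
  then obtain Y where Y: "finite {w \<in> lists A. Y w \<noteq> UNIV}" "\<one>\<^bsub>power_series A\<^esub> \<in> Pi\<^sub>E (lists A) Y"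
      "Pi\<^sub>E (lists A) Y \<subseteq> W"
    unfolding power_series_topology_def openin_product_topology_alt by force
  have "{a \<in> A. ?\<phi> a \<notin> V} \<subseteq> hd ` {w \<in> lists A. Y w \<noteq> UNIV}"
  proof
    fix a assume "a \<in> {a \<in> A. ?\<phi> a \<notin> V}"
    then have a: "a \<in> A" "?\<phi> a \<notin> V" by auto
    have "?\<phi> a \<in> carrier ?G"
      using a(1) by (auto simp: power_series_def series_var_def magnus_group_def)
    then have "?\<phi> a \<notin> Pi\<^sub>E (lists A) Y"
      using a(2) W Y by blast
    moreover have "?\<phi> a \<in> extensional (lists A)"
      by (simp add: power_series_def)
    ultimately obtain w where w: "w \<in> lists A" "?\<phi> a w \<notin> Y w"
      unfolding PiE_def by blast
    have "w = [a]"
    proof (rule ccontr)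
      assume "w \<noteq> [a]"
      then have "?\<phi> a w = \<one>\<^bsub>power_series A\<^esub> w"
        using w(1) by (simp add: power_series_def series_var_def)
      then show False
        using w PiE_mem[OF Y(2)] by auto
    qed
    moreover have "Y w \<noteq> UNIV"
      using w by auto
    ultimately show "a \<in> hd ` {w \<in> lists A. Y w \<noteq> UNIV}"
      using w(1) by (intro image_eqI[of _ _ w]) auto
  qed
  then show "finite {a \<in> A. ?\<phi> a \<notin> V}"
    using Y(1) finite_surj by blast
qed

lemma magnus_exists:
  obtains h :: "'s \<Rightarrow> 'a list \<Rightarrow> 'r::{finite,comm_ring_1}"
  where "h \<in> continuous_hom S T (magnus_group A) (magnus_topology A)"
    and "\<And>a. a \<in> A \<Longrightarrow> h (\<iota> a) = \<one>\<^bsub>power_series A\<^esub> \<oplus>\<^bsub>power_series A\<^esub> series_var A a"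
proof -
  obtain j :: "'r \<Rightarrow> nat" where j: "inj j"
    using finite_imp_inj_to_nat_seg[of "UNIV :: 'r set"] by auto
  \<comment> \<open>The graph of a series, with coefficients numbered by \<open>j\<close>, is a set
    of pairs of a word and a natural number: an element of the type for which
    \<open>universal\<close> is stated.\<close>
  define e where "e f = (\<lambda>w. (w, j (f w))) ` lists A" for f :: "'a list \<Rightarrow> 'r"
  have "inj_on e (carrier (magnus_group A))"
  proof (rule inj_onI)
    fix f g :: "'a list \<Rightarrow> 'r"
    assume fg: "f \<in> carrier (magnus_group A)" "g \<in> carrier (magnus_group A)" "e f = e g"
    have "f w = g w" if "w \<in> lists A" for w
    proof -
      have "(w, j (f w)) \<in> e g"
        using that fg(3) unfolding e_def by blast
      then show ?thesis
        using j by (auto simp: e_def inj_eq)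
    qed
    then show "f = g"
      using fg by (intro PiE_ext[of f "lists A" "\<lambda>_. UNIV"]) (auto simp: magnus_group_def)
  qed
  from universal_embedded[OF profinite_magnus_group this converges_to_one_magnus]
  show ?thesis
    using that by metis
qed

text \<open>\<open>magnus\<close> is described among maps into the whole unit group. Existence comes
  from the smaller group \<open>magnus_group A\<close>; uniqueness is checked in the unit group,
  whose topology is Hausdorff.\<close>

lemma magnus_in_continuous_hom:
  "(magnus A S T \<iota> :: 's \<Rightarrow> 'a list \<Rightarrow> 'r::{finite,comm_ring_1})
     \<in> continuous_hom S T (magnus_group A) (magnus_topology A)" (is ?hom)
  and magnus_basis: "a \<in> A \<Longrightarrow>
     (magnus A S T \<iota> (\<iota> a) :: 'a list \<Rightarrow> 'r) = \<one>\<^bsub>power_series A\<^esub> \<oplus>\<^bsub>power_series A\<^esub> series_var A a"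
proof -
  let ?H = "units_of (power_series A) :: ('a list \<Rightarrow> 'r) monoid"
  let ?U = "subtopology (power_series_topology A) (Units (power_series A)) :: ('a list \<Rightarrow> 'r) topology"
  obtain h :: "'s \<Rightarrow> 'a list \<Rightarrow> 'r"
    where h: "h \<in> continuous_hom S T (magnus_group A) (magnus_topology A)"
      and ha: "\<And>a. a \<in> A \<Longrightarrow> h (\<iota> a) = \<one>\<^bsub>power_series A\<^esub> \<oplus>\<^bsub>power_series A\<^esub> series_var A a"
    using magnus_exists by metis
  have "h x \<in> Units (power_series A)" if "x \<in> carrier S" for x
    using h that magnus_group_subset_Units[of A] by (auto simp: continuous_hom_def hom_def)
  then have hH: "h \<in> continuous_hom S T ?H ?U"
    using h
    by (auto simp: topspace_eq continuous_hom_def hom_def units_of_def magnus_group_def magnus_topology_def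
        continuous_map_in_subtopology)
  have "Hausdorff_space ?U"
    by (simp add: power_series_topology_def Hausdorff_space_product_topology Hausdorff_space_subtopology)
  moreover have "group ?H"
    by (rule monoid.units_group[OF monoid_power_series])
  ultimately have uniq: "\<Lambda> = h" if "\<Lambda> \<in> continuous_hom S T ?H ?U"
      "\<forall>a\<in>A. \<Lambda> (\<iota> a) = \<one>\<^bsub>power_series A\<^esub> \<oplus>\<^bsub>power_series A\<^esub> series_var A a" for \<Lambda>
    using that ha hH by (intro continuous_hom_unique[of ?H ?U]) simp_all
  have eq: "magnus A S T \<iota> = h"
    unfolding magnus_def by (rule the_equality) (blast intro: hH ha uniq)+
  show ?hom
    unfolding eq by (rule h)
  show "(magnus A S T \<iota> (\<iota> a) :: 'a list \<Rightarrow> 'r) = \<one>\<^bsub>power_series A\<^esub> \<oplus>\<^bsub>power_series A\<^esub> series_var A a"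
    if "a \<in> A"
    unfolding eq using that by (rule ha)
qed

section \<open>Magnus coefficients as functions on \<open>S\<close>\<close>

abbreviation coeff :: "'a list \<Rightarrow> 's \<Rightarrow> 'r::{finite,comm_ring_1}" ("\<epsilon>") where
  "coeff \<equiv> magnus_coeff A S T \<iota>"

lemma coeff_Nil:
  assumes "x \<in> carrier S"
  shows "\<epsilon> [] x = (1 :: 'r::{finite,comm_ring_1})"
proof -
  have "(magnus A S T \<iota> x :: 'a list \<Rightarrow> 'r) \<in> carrier (magnus_group A)"
    using magnus_in_continuous_hom assms unfolding continuous_hom_def hom_def by blast
  then show ?thesis
    by (simp add: magnus_coeff_def magnus_group_def)
qed

lemma coeff_mult:
  assumes "x \<in> carrier S" "y \<in> carrier S" "w \<in> lists A"
  shows "\<epsilon> w (x \<otimes> y) = (\<Sum>k\<le>length w. \<epsilon> (take k w) x * \<epsilon> (drop k w) y :: 'r::{finite,comm_ring_1})"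
proof -
  have "(magnus A S T \<iota> (x \<otimes> y) :: 'a list \<Rightarrow> 'r) =
      magnus A S T \<iota> x \<otimes>\<^bsub>power_series A\<^esub> magnus A S T \<iota> y"
    using magnus_in_continuous_hom[where 'r = 'r] assms(1,2)
    by (auto simp: continuous_hom_def hom_def magnus_group_def)
  then show ?thesis
    using assms(3) by (simp add: magnus_coeff_def mult_power_series conv_def)
qed

lemma continuous_coeff:
  assumes "w \<in> lists A"
  shows "continuous_map T (discrete_topology UNIV) (\<epsilon> w :: 's \<Rightarrow> 'r::{finite,comm_ring_1})"
proof -
  have "continuous_map T (magnus_topology A) (magnus A S T \<iota> :: 's \<Rightarrow> 'a list \<Rightarrow> 'r)"
    using magnus_in_continuous_hom by (auto simp: continuous_hom_def)
  from continuous_map_compose[OF this continuous_map_magnus_coordinate[OF assms]]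
  show ?thesis
    by (simp add: o_def magnus_coeff_def[abs_def])
qed

lemma coeff_basis:
  "a \<in> A \<Longrightarrow> w \<in> lists A \<Longrightarrow>
    \<epsilon> w (\<iota> a) = (if w = [] \<or> w = [a] then 1 else 0 :: 'r::{finite,comm_ring_1})"
  by (simp add: magnus_coeff_def magnus_basis power_series_def series_var_def)

end

section \<open>Truncated Magnus expansions of unitriangular representations\<close>

text \<open>The \<open>(i, k)\<close> entry of the product, along the word, of the strictly upper
  triangular parts of the matrices \<open>M a\<close>, as a sum over increasing paths from
  \<open>i\<close> to \<open>k\<close>. The value \<open>r = k\<close> is allowed because the rest
  of the word may be empty.\<close>

fun path_weight :: "('a \<Rightarrow> nat \<Rightarrow> nat \<Rightarrow> 'r::comm_ring_1) \<Rightarrow> 'a list \<Rightarrow> nat \<Rightarrow> nat \<Rightarrow> 'r" where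
  "path_weight M [] i k = (if i = k then 1 else 0)"
| "path_weight M (a # u) i k = (\<Sum>r\<in>{i<..k}. M a i r * path_weight M u r k)"

text \<open>Each letter raises the index by at least 1. This nilpotency makes words longer than
  \<open>n\<close> irrelevant for matrices of size \<open>n + 1\<close>.\<close>

lemma path_weight_eq_0: "k < i + length u \<Longrightarrow> path_weight M u i k = 0"
  by (induction u arbitrary: i) (auto intro!: sum.neutral)

lemma path_weight_append:
  "path_weight M (u @ v) i k = (\<Sum>r\<in>{i..k}. path_weight M u i r * path_weight M v r k)"
proof (induction u arbitrary: i)
  case Nil
  have "(\<Sum>r\<in>{i..k}. path_weight M [] i r * path_weight M v r k) =
      (\<Sum>r\<in>{i..k}. if r = i then path_weight M v r k else 0)"
    by (intro sum.cong) auto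
  then show ?case
    using path_weight_eq_0[of k i v M] by (simp add: sum.delta)
next
  case (Cons a u)
  have "path_weight M ((a # u) @ v) i k =
      (\<Sum>r\<in>{i<..k}. \<Sum>s\<in>{r..k}. M a i r * path_weight M u r s * path_weight M v s k)"
    by (simp add: Cons.IH sum_distrib_left mult.assoc)
  \<comment> \<open>The range of \<open>s\<close> is made independent of \<open>r\<close> so that
    the sums can be swapped; the added terms have \<open>s < r\<close>, where the weight of
    \<open>u\<close> vanishes. The later cut to \<open>r \<le> s\<close> drops terms of the same
    kind.\<close>
  also have "\<dots> = (\<Sum>r\<in>{i<..k}. \<Sum>s\<in>{i..k}. M a i r * path_weight M u r s * path_weight M v s k)"
    by (intro sum.cong sum.mono_neutral_left) (auto simp: path_weight_eq_0)
  also have "\<dots> = (\<Sum>s\<in>{i..k}. \<Sum>r\<in>{i<..k}. M a i r * path_weight M u r s * path_weight M v s k)"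
    by (rule sum.swap)
  also have "\<dots> = (\<Sum>s\<in>{i..k}. \<Sum>r\<in>{i<..s}. M a i r * path_weight M u r s * path_weight M v s k)"
    by (intro sum.cong sum.mono_neutral_right) (auto simp: path_weight_eq_0)
  also have "\<dots> = (\<Sum>s\<in>{i..k}. path_weight M (a # u) i s * path_weight M v s k)"
    by (simp add: sum_distrib_right)
  finally show ?case .
qed

lemma path_weight_singleton: "i < k \<Longrightarrow> path_weight M [a] i k = M a i k"
proof -
  assume "i < k"
  have "path_weight M [a] i k = (\<Sum>r\<in>{i<..k}. if r = k then M a i r else 0)"
    unfolding path_weight.simps by (intro sum.cong) auto
  then show ?thesis
    using \<open>i < k\<close> by (simp add: sum.delta)
qed

text \<open>With as many letters as units to climb, the only path takes unit steps.\<close>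

lemma path_weight_length:
  "path_weight M u i (i + length u) = (\<Prod>l<length u. M (u ! l) (i + l) (i + l + 1))"
proof (induction u arbitrary: i)
  case (Cons a u)
  have "path_weight M (a # u) i (i + length (a # u)) =
      (\<Sum>r\<in>{i<..i + length (a # u)}. if r = i + 1 then M a i r * path_weight M u r (i + length (a # u)) else 0)"
    unfolding path_weight.simps by (intro sum.cong) (auto simp: path_weight_eq_0)
  also have "\<dots> = M a i (i + 1) * path_weight M u (i + 1) (i + 1 + length u)"
    by (simp add: sum.delta)
  also have "\<dots> = (\<Prod>l<length (a # u). M ((a # u) ! l) (i + l) (i + l + 1))"
    using Cons.IH[of "i + 1"] by (simp add: prod.lessThan_Suc_shift del: prod.lessThan_Suc)
  finally show ?case .
qed simp

definition short_words :: "'a set \<Rightarrow> nat \<Rightarrow> 'a list set" where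
  "short_words B n = {u. set u \<subseteq> B \<and> length u \<le> n}"

lemma finite_short_words: "finite B \<Longrightarrow> finite (short_words B n)"
  unfolding short_words_def by (rule finite_lists_length_le)

context free_profinite_group
begin

text \<open>The \<open>(i, k)\<close> entry of the Magnus series of \<open>x\<close> after X_a is
  replaced by the strictly upper triangular part of \<open>M a\<close> for \<open>a\<close> in
  \<open>B\<close> and by 0 otherwise. For \<open>k \<le> i + n\<close> the truncation at length
  \<open>n\<close> loses nothing.\<close>

definition expansion ::
  "('a \<Rightarrow> nat \<Rightarrow> nat \<Rightarrow> 'r::{finite,comm_ring_1}) \<Rightarrow> 'a set \<Rightarrow> nat \<Rightarrow> 's \<Rightarrow> nat \<Rightarrow> nat \<Rightarrow> 'r" where
  "expansion M B n x i k = (\<Sum>u\<in>short_words B n. \<epsilon> u x * path_weight M u i k)"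

context
  fixes B :: "'a set" and n :: nat and M :: "'a \<Rightarrow> nat \<Rightarrow> nat \<Rightarrow> 'r::{finite,comm_ring_1}"
  assumes finite: "finite B" and sub: "B \<subseteq> A"
begin

lemma short_words_in_lists: "u \<in> short_words B n \<Longrightarrow> u \<in> lists A"
  using sub by (auto simp: short_words_def)

text \<open>A matrix product of weights is a weight of a concatenation, and
  \<open>coeff_mult\<close> sums over the cuts of a word. The bound on \<open>k\<close> kills the
  pairs whose concatenation exceeds the truncation.\<close>

lemma expansion_mult:
  assumes x: "x \<in> carrier S" and y: "y \<in> carrier S" and k: "k \<le> i + n"
  shows "expansion M B n (x \<otimes> y) i k = (\<Sum>r\<in>{i..k}. expansion M B n x i r * expansion M B n y r k)"
proof -
  let ?W = "short_words B n"
  let ?P = "\<lambda>(u, v). \<epsilon> u x * \<epsilon> v y * path_weight M (u @ v) i k"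
  have fin: "finite ?W"
    by (rule finite_short_words[OF finite])
  have "(\<Sum>r\<in>{i..k}. expansion M B n x i r * expansion M B n y r k) =
      (\<Sum>r\<in>{i..k}. \<Sum>p\<in>?W \<times> ?W.
        (\<epsilon> (fst p) x * path_weight M (fst p) i r) * (\<epsilon> (snd p) y * path_weight M (snd p) r k))"
    by (simp add: expansion_def sum_product sum.cartesian_product case_prod_unfold)
  also have "\<dots> = (\<Sum>p\<in>?W \<times> ?W. \<Sum>r\<in>{i..k}.
        (\<epsilon> (fst p) x * path_weight M (fst p) i r) * (\<epsilon> (snd p) y * path_weight M (snd p) r k))"
    by (rule sum.swap)
  also have "\<dots> = (\<Sum>p\<in>?W \<times> ?W. ?P p)"
    by (intro sum.cong) (simp_all add: path_weight_append sum_distrib_left case_prod_unfold algebra_simps)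
  also have "\<dots> = (\<Sum>p\<in>{(u, v) \<in> ?W \<times> ?W. length u + length v \<le> n}. ?P p)"
  proof (rule sum.mono_neutral_right)
    show "\<forall>p\<in>?W \<times> ?W - {(u, v) \<in> ?W \<times> ?W. length u + length v \<le> n}. ?P p = 0"
    proof
      fix p assume "p \<in> ?W \<times> ?W - {(u, v) \<in> ?W \<times> ?W. length u + length v \<le> n}"
      then have "k < i + length (fst p @ snd p)"
        using k by auto
      then show "?P p = 0"
        by (simp add: case_prod_unfold path_weight_eq_0)
    qed
  qed (use fin in auto)
  \<comment> \<open>A pair of words is the same as their concatenation with a marked cut.\<close>
  also have "\<dots> = (\<Sum>p\<in>(SIGMA w:?W. {..length w}). \<epsilon> (take (snd p) (fst p)) x * \<epsilon> (drop (snd p) (fst p)) y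
        * path_weight M (fst p) i k)"
    by (rule sum.reindex_bij_witness[where i = "\<lambda>p. (take (snd p) (fst p), drop (snd p) (fst p))"
          and j = "\<lambda>p. (fst p @ snd p, length (fst p))"])
       (auto simp: short_words_def subset_iff dest: in_set_takeD in_set_dropD)
  also have "\<dots> = (\<Sum>w\<in>?W. \<Sum>j\<in>{..length w}. \<epsilon> (take j w) x * \<epsilon> (drop j w) y * path_weight M w i k)"
    using fin by (subst sum.Sigma) (auto simp: case_prod_unfold)
  also have "\<dots> = expansion M B n (x \<otimes> y) i k"
    unfolding expansion_def
    by (intro sum.cong) (simp_all add: coeff_mult[OF x y] short_words_in_lists sum_distrib_right)
  finally show ?thesis
    by simp
qed

lemma continuous_expansion:
  "continuous_map T (discrete_topology UNIV) (\<lambda>x. expansion M B n x i k)"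
  unfolding expansion_def using finite_short_words[OF finite]
  by (intro continuous_map_discrete_sum continuous_map_discrete_arith)
    (simp_all add: continuous_coeff short_words_in_lists)

lemma expansion_diagonal:
  assumes "x \<in> carrier S"
  shows "expansion M B n x i i = 1"
proof -
  have "expansion M B n x i i = (\<Sum>u\<in>short_words B n. if u = [] then 1 else 0)"
    unfolding expansion_def
    by (intro sum.cong) (auto simp: coeff_Nil[OF assms] path_weight_eq_0)
  then show ?thesis
    using finite_short_words[OF finite] by (simp add: short_words_def sum.delta)
qed

text \<open>The series of \<open>\<iota> a\<close> is 1 + X_a. The word \<open>[]\<close>
  contributes nothing off the diagonal, and \<open>n \<ge> 1\<close> keeps \<open>[a]\<close> within
  the truncation.\<close>

lemma expansion_basis:
  assumes "a \<in> A" "i < k" "n \<ge> 1"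
  shows "expansion M B n (\<iota> a) i k = (if a \<in> B then M a i k else 0)"
proof -
  have "expansion M B n (\<iota> a) i k = (\<Sum>u\<in>short_words B n. if u = [a] then M a i k else 0)"
    unfolding expansion_def
    using assms path_weight_singleton[OF assms(2), of M a]
    by (intro sum.cong) (auto simp: coeff_basis short_words_in_lists simp del: path_weight.simps(2))
  then show ?thesis
    using finite_short_words[OF finite] assms by (simp add: short_words_def sum.delta)
qed

end

text \<open>The zero set of \<open>f\<close> is an open neighbourhood of \<open>\<one>\<close>, so
  convergence of the basis applies to it.\<close>

lemma finite_basis_support:
  assumes f: "continuous_map T (discrete_topology UNIV) f" and "f \<one> = (0 :: 'r::comm_ring_1)"
  shows "finite {a \<in> A. f (\<iota> a) \<noteq> 0}"
proof -
  have "openin T {x \<in> topspace T. f x \<in> {0}}"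
    using f by (rule openin_continuous_map_preimage) simp
  moreover have "\<one> \<in> {x \<in> topspace T. f x \<in> {0}}"
    using assms(2) by (simp add: topspace_eq)
  ultimately have "finite {a \<in> A. \<iota> a \<notin> {x \<in> topspace T. f x \<in> {0}}}"
    using basis_converges unfolding converges_to_one_def by blast
  then show ?thesis
    by (rule rev_finite_subset) auto
qed

lemma additive_vanishes_on_filtration:
  fixes f :: "'s \<Rightarrow> 'r::{finite,comm_ring_1}"
  assumes cont: "continuous_map T (discrete_topology UNIV) f"
    and add: "\<And>x y. x \<in> carrier S \<Longrightarrow> y \<in> carrier S \<Longrightarrow> f (x \<otimes> y) = f x + f y"
    and n: "n \<ge> 2" and x: "x \<in> magnus_filtration A S T \<iota> TYPE('r) n"
  shows "f x = 0"
proof -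
  define B where "B = {a \<in> A. f (\<iota> a) \<noteq> 0}"
  have "f \<one> = 0"
    using add[of \<one> \<one>] by simp
  then have B: "finite B"
    unfolding B_def by (rule finite_basis_support[OF cont])
  \<comment> \<open>Coefficients of one-letter words are additive and dual to the basis, so
    \<open>g\<close> is additive and kills the basis.\<close>
  define g where "g y = f y - (\<Sum>a\<in>B. f (\<iota> a) * \<epsilon> [a] y)" for y
  have "continuous_map T (discrete_topology UNIV) (\<epsilon> [a] :: 's \<Rightarrow> 'r)" if "a \<in> B" for a
    using that by (intro continuous_coeff) (simp add: B_def)
  then have "continuous_map T (discrete_topology UNIV) g"
    unfolding g_def using cont B
    by (intro continuous_map_discrete_sum continuous_map_discrete_arith) simp_all
  moreover have "g (y \<otimes> z) = g y + g z" if "y \<in> carrier S" "z \<in> carrier S" for y z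
  proof -
    have "(\<Sum>a\<in>B. f (\<iota> a) * \<epsilon> [a] (y \<otimes> z)) = (\<Sum>a\<in>B. f (\<iota> a) * \<epsilon> [a] y + f (\<iota> a) * \<epsilon> [a] z)"
      using that by (intro sum.cong) (simp_all add: coeff_mult B_def coeff_Nil algebra_simps)
    then show ?thesis
      using that by (simp add: g_def add sum.distrib)
  qed
  moreover have "g (\<iota> a) = 0" if "a \<in> A" for a
  proof -
    have "(\<Sum>b\<in>B. f (\<iota> b) * \<epsilon> [b] (\<iota> a)) = (\<Sum>b\<in>B. if b = a then f (\<iota> b) else 0)"
      using that by (intro sum.cong) (auto simp: coeff_basis B_def)
    then show ?thesis
      using that B by (simp add: g_def sum.delta B_def)
  qed
  moreover have "x \<in> carrier S"
    using x by (simp add: magnus_filtration_def)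
  ultimately have "g x = 0"
    by (rule additive_eq_zero)
  moreover have "\<epsilon> [a] x = (0 :: 'r)" if "a \<in> B" for a
    using x n that by (auto simp: magnus_filtration_def B_def)
  ultimately show ?thesis
    by (simp add: g_def)
qed

text \<open>
  \<open>c i k\<close>, for \<open>1 \<le> i < k \<le> n + 1\<close>, are the entries above the diagonal of a unitriangular
  representation of size \<open>n + 1\<close> whose corner entry \<open>(1, n + 1)\<close> is unknown.  The representation
  sending \<open>\<iota> a\<close> to the matrix with corner entry 0 extends to the ring of power series, whence its
  value at \<open>x\<close> is the sum over all words \<open>u\<close> of \<open>\<epsilon> u x\<close> times the product of the strictly upper
  triangular parts at the letters of \<open>u\<close>.
\<close>

lemma unitriangular_corner:
  fixes c :: "nat \<Rightarrow> nat \<Rightarrow> 's \<Rightarrow> 'r::{finite,comm_ring_1}"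
  assumes n: "n \<ge> 2" and w: "w \<in> lists A" "length w = n"
    and cont: "\<And>i k. \<lbrakk>1 \<le> i; i < k; k \<le> n + 1; (i, k) \<noteq> (1, n + 1)\<rbrakk>
      \<Longrightarrow> continuous_map T (discrete_topology UNIV) (c i k)"
    and mult: "\<And>i k x y. \<lbrakk>1 \<le> i; i < k; k \<le> n + 1; (i, k) \<noteq> (1, n + 1); x \<in> carrier S; y \<in> carrier S\<rbrakk>
      \<Longrightarrow> c i k (x \<otimes> y) = c i k x + c i k y + (\<Sum>r\<in>{i<..<k}. c i r x * c r k y)"
    and diag: "\<And>i x. \<lbrakk>1 \<le> i; i \<le> n; x \<in> carrier S\<rbrakk> \<Longrightarrow> c i (i + 1) x = \<epsilon> [w ! (i - 1)] x"
  obtains y where "continuous_map T (discrete_topology UNIV) y"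
    and "\<And>x x'. \<lbrakk>x \<in> carrier S; x' \<in> carrier S\<rbrakk>
      \<Longrightarrow> y (x \<otimes> x') = y x + y x' + (\<Sum>r\<in>{1<..<n + 1}. c 1 r x * c r (n + 1) x')"
    and "\<And>x. x \<in> magnus_filtration A S T \<iota> TYPE('r) n \<Longrightarrow> y x = \<epsilon> w x"
proof -
  define R where "R = {(i, k). 1 \<le> i \<and> i < k \<and> k \<le> n + 1 \<and> (i, k) \<noteq> (1, n + 1)}"
  \<comment> \<open>The corner spans the full distance \<open>n\<close>, so splitting at an
    intermediate index never produces it, and inductions on \<open>k - i\<close> stay among the
    given entries.\<close>
  have R_sub: "(i, r) \<in> R \<and> (r, k) \<in> R" if "1 \<le> i" "k \<le> n + 1" "i < r" "r < k" for i r k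
    using that by (auto simp: R_def)
  have c_one: "c i k \<one> = 0" if "(i, k) \<in> R" for i k
    using that
  proof (induction "k - i" arbitrary: i k rule: less_induct)
    case less
    then have ik: "1 \<le> i" "i < k" "k \<le> n + 1" "(i, k) \<noteq> (1, n + 1)"
      by (auto simp: R_def)
    have "c i r \<one> = 0" if "r \<in> {i<..<k}" for r
      using that ik R_sub[of i k r] by (intro less(1)) auto
    then have "(\<Sum>r\<in>{i<..<k}. c i r \<one> * c r k \<one>) = 0"
      by (intro sum.neutral) simp
    then show ?case
      using mult[OF ik, of \<one> \<one>] by simp
  qed
  \<comment> \<open>Letters outside \<open>B\<close> act trivially at all positions in
    \<open>R\<close>. The letters of \<open>w\<close> are added so that \<open>w\<close> itself
    occurs in the truncated sum.\<close>
  define B where "B = set w \<union> (\<Union>(i, k)\<in>R. {a \<in> A. c i k (\<iota> a) \<noteq> 0})"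
  have "R \<subseteq> {..n + 1} \<times> {..n + 1}"
    by (auto simp: R_def)
  then have "finite R"
    by (rule finite_subset) simp
  moreover have "finite {a \<in> A. c i k (\<iota> a) \<noteq> 0}" if "(i, k) \<in> R" for i k
    using that c_one[OF that] cont[of i k] by (intro finite_basis_support) (auto simp: R_def)
  ultimately have finB: "finite B"
    unfolding B_def by auto
  have BA: "B \<subseteq> A"
    using w(1) by (auto simp: B_def)
  \<comment> \<open>The value 0 is a free choice: at the corner it enters only the weights of
    one-letter words, whose coefficients vanish on the filtration because
    \<open>n \<ge> 2\<close>.\<close>
  define M where "M a i k = (if (i, k) = (1, n + 1) then 0 else c i k (\<iota> a))" for a i k
  define E where "E = expansion M B n"
  have E_cont: "continuous_map T (discrete_topology UNIV) (\<lambda>x. E x i k)" for i k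
    unfolding E_def by (rule continuous_expansion[OF finB BA])
  have E_mult: "E (x \<otimes> y) i k = E x i k + E y i k + (\<Sum>r\<in>{i<..<k}. E x i r * E y r k)"
    if "1 \<le> i" "i < k" "k \<le> n + 1" "x \<in> carrier S" "y \<in> carrier S" for i k x y
  proof -
    have "{i..k} = insert i (insert k {i<..<k})"
      using that by auto
    then show ?thesis
      using that unfolding E_def
      by (simp add: expansion_mult[OF finB BA] expansion_diagonal[OF finB BA])
  qed
  have E_eq: "E x i k = c i k x" if "(i, k) \<in> R" "x \<in> carrier S" for i k x
    using that
  proof (induction "k - i" arbitrary: i k x rule: less_induct)
    case less
    then have ik: "1 \<le> i" "i < k" "k \<le> n + 1" "(i, k) \<noteq> (1, n + 1)"
      by (auto simp: R_def)
    \<comment> \<open>By induction both entries fail to be additive by the same sum of products, so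
      their difference is additive. On the basis they agree: inside \<open>B\<close> by the choice
      of \<open>M\<close>, outside because both are 0.\<close>
    have "E x i k - c i k x = 0"
    proof (rule additive_eq_zero[where f = "\<lambda>x. E x i k - c i k x"])
      show "continuous_map T (discrete_topology UNIV) (\<lambda>x. E x i k - c i k x)"
        using E_cont cont[OF ik] by (rule continuous_map_discrete_arith)
      show "E (y \<otimes> z) i k - c i k (y \<otimes> z) = (E y i k - c i k y) + (E z i k - c i k z)"
        if "y \<in> carrier S" "z \<in> carrier S" for y z
      proof -
        have "E y i r = c i r y \<and> E z r k = c r k z" if "r \<in> {i<..<k}" for r
          using that ik R_sub[of i k r] \<open>y \<in> carrier S\<close> \<open>z \<in> carrier S\<close> by (auto intro!: less(1))
        then show ?thesis
          using that ik by (simp add: E_mult mult)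
      qed
      show "E (\<iota> a) i k - c i k (\<iota> a) = 0" if "a \<in> A" for a
        using that ik n less(2) expansion_basis[OF finB BA that, of i k n M]
        by (auto simp: E_def M_def B_def)
    qed fact
    then show ?case by simp
  qed
  show ?thesis
  proof
    show "continuous_map T (discrete_topology UNIV) (\<lambda>x. E x 1 (n + 1))"
      by (rule E_cont)
    show "E (x \<otimes> x') 1 (n + 1) = E x 1 (n + 1) + E x' 1 (n + 1) + (\<Sum>r\<in>{1<..<n + 1}. c 1 r x * c r (n + 1) x')"
      if "x \<in> carrier S" "x' \<in> carrier S" for x x'
      using that n E_eq R_sub[of 1 "n + 1"] by (simp add: E_mult)
    show "E x 1 (n + 1) = \<epsilon> w x" if x: "x \<in> magnus_filtration A S T \<iota> TYPE('r) n" for x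
    proof -
      have "\<epsilon> u x * path_weight M u 1 (n + 1) = (if u = w then \<epsilon> w x else 0)"
        if u: "u \<in> short_words B n" for u
      proof (cases "length u = n")
        case True
        have uA: "u ! l \<in> A" if "l < n" for l
          using u BA True that nth_mem[of l u] unfolding short_words_def by blast
        have "path_weight M u 1 (n + 1) = (\<Prod>l<n. M (u ! l) (1 + l) (1 + l + 1))"
          using path_weight_length[of M u 1] True by (simp add: add.commute)
        also have "\<dots> = (\<Prod>l<n. if u ! l = w ! l then 1 else 0)"
        proof (rule prod.cong)
          \<comment> \<open>Letter \<open>l\<close>, counted from 0, sits at the superdiagonal
            position \<open>(l + 1, l + 2)\<close>, which is not the corner since
            \<open>n \<ge> 2\<close>. There \<open>diag\<close> gives the coefficient of
            \<open>[w ! l]\<close> at a basis element.\<close>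
          fix l assume "l \<in> {..<n}"
          then show "M (u ! l) (1 + l) (1 + l + 1) = (if u ! l = w ! l then 1 else 0)"
            using n diag[of "1 + l" "\<iota> (u ! l)"] uA[of l] w nth_mem[of l w]
            by (auto simp: M_def coeff_basis \<iota>_closed)
        qed simp
        also have "\<dots> = (if u = w then 1 else 0)"
        proof (cases "u = w")
          case False
          then obtain l where "l < n" "u ! l \<noteq> w ! l"
            using True w(2) nth_equalityI by metis
          then show ?thesis
            using False by (auto intro!: prod_zero)
        qed simp
        finally show ?thesis
          by simp
      next
        case False
        then have "length u < n" "u \<in> lists A"
          using u BA by (auto simp: short_words_def)
        \<comment> \<open>For the empty word the coefficient is 1 and it is the weight that
          vanishes; for the other short words it is the coefficient.\<close>
        then have "\<epsilon> u x * path_weight M u 1 (n + 1) = 0"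
          using x n by (cases u) (auto simp: magnus_filtration_def simp del: path_weight.simps(2))
        then show ?thesis
          using False w(2) by auto
      qed
      then have "E x 1 (n + 1) = (\<Sum>u\<in>short_words B n. if u = w then \<epsilon> w x else 0)"
        unfolding E_def expansion_def by (intro sum.cong) auto
      moreover have "w \<in> short_words B n"
        using w(2) by (simp add: short_words_def B_def)
      ultimately show ?thesis
        using finite_short_words[OF finB] by (simp add: sum.delta)
    qed
  qed
qed

end

section \<open>Open subgroups of profinite groups\<close>

context profinite_group
begin

lemma continuous_translations:
  assumes "g \<in> carrier G"
  shows "continuous_map T T (\<lambda>x. g \<otimes> x)" and "continuous_map T T (\<lambda>x. x \<otimes> g)"
proof -
  have "continuous_map T (prod_topology T T) (\<lambda>x. (g, x))" "continuous_map T (prod_topology T T) (\<lambda>x. (x, g))"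
    using assms by (simp_all add: continuous_map_paired topspace_eq)
  from this[THEN continuous_map_compose, OF continuous_mult]
  show "continuous_map T T (\<lambda>x. g \<otimes> x)" "continuous_map T T (\<lambda>x. x \<otimes> g)"
    by (simp_all add: o_def)
qed

lemma openin_translate:
  assumes "openin T U" "g \<in> carrier G"
  shows "openin T {x \<in> carrier G. g \<otimes> x \<in> U}"
  using openin_continuous_map_preimage[OF continuous_translations(1)[OF assms(2)] assms(1)]
  by (simp add: topspace_eq)

text \<open>The elements whose right translation maps \<open>C\<close> into itself form an open set
  by compactness of \<open>C\<close>. Those whose inverse does so too form a subgroup, which lies in
  \<open>C\<close> because \<open>\<one>\<close> does.\<close>

lemma open_subgroup_in_clopen:
  assumes C: "openin T C" "closedin T C" "\<one> \<in> C"
  obtains V where "subgroup V G" "openin T V" "V \<subseteq> C"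
proof -
  define P where "P = {x \<in> carrier G. \<forall>c\<in>C. c \<otimes> x \<in> C}"
  have CG: "C \<subseteq> carrier G"
    using C closedin_subset topspace_eq by blast
  let ?T = "prod_topology (subtopology T C) T"
  have "continuous_map ?T T (\<lambda>(x, y). x \<otimes> y)"
    using continuous_map_from_subtopology[OF continuous_mult, of "C \<times> topspace T"]
    by (simp add: prod_topology_subtopology(1))
  then have "closedin ?T {p \<in> topspace ?T. (\<lambda>(x, y). x \<otimes> y) p \<in> topspace T - C}"
    by (rule closedin_continuous_map_preimage) (use C(1) in auto)
  \<comment> \<open>Projection along the compact factor \<open>C\<close> is closed; it sends the
    pairs whose product leaves \<open>C\<close> onto the complement of \<open>P\<close>.\<close>
  moreover have "closed_map ?T T snd"
    using C(2) compact by (intro closed_map_snd compact_space_subtopology closedin_compact_space)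
  ultimately have "closedin T (snd ` {p \<in> topspace ?T. (\<lambda>(x, y). x \<otimes> y) p \<in> topspace T - C})"
    by (simp add: closed_map_def)
  moreover have "snd ` {p \<in> topspace ?T. (\<lambda>(x, y). x \<otimes> y) p \<in> topspace T - C} = topspace T - P"
    using CG by (force simp: P_def topspace_eq image_iff)
  ultimately have P: "openin T P"
    by (auto simp: closedin_def P_def topspace_eq Diff_Diff_Int Int_absorb1)
  define V where "V = P \<inter> {x \<in> topspace T. inv x \<in> P}"
  show ?thesis
  proof
    show "openin T V"
      unfolding V_def using P openin_continuous_map_preimage[OF continuous_inv P] by blast
    show "V \<subseteq> C"
      using C(3) by (auto simp: V_def P_def)
    show "subgroup V G"
    proof (rule subgroupI)
      have "\<one> \<in> V"
        using CG by (auto simp: V_def P_def topspace_eq subset_iff)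
      then show "V \<noteq> {}"
        by blast
      show "inv x \<in> V" if "x \<in> V" for x
        using that by (auto simp: V_def P_def topspace_eq)
      show "x \<otimes> y \<in> V" if "x \<in> V" "y \<in> V" for x y
        using that CG by (auto simp: V_def P_def topspace_eq inv_mult_group subset_iff simp flip: m_assoc)
    qed (auto simp: V_def P_def)
  qed
qed

text \<open>In a compact Hausdorff space quasi-components are components, here points. So a clopen
  set separates \<open>\<one>\<close> from \<open>J\<close>, and a subgroup is found inside
  it.\<close>

lemma open_subgroup_avoiding:
  assumes J: "closedin T J" "\<one> \<notin> J"
  obtains V where "subgroup V G" "openin T V" "V \<inter> J = {}"
proof -
  let ?C = "quasi_component_of_set T \<one>"
  have C: "?C \<in> quasi_components_of T"
    by (simp add: quasi_components_of_def topspace_eq)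
  then have "?C \<in> connected_components_of T"
    using quasi_eq_connected_components_of[of T] compact Hausdorff by blast
  then have "connectedin T ?C"
    by (rule connectedin_connected_components_of)
  then obtain x where "?C \<subseteq> {x}"
    using totally_disconnected by blast
  moreover have "\<one> \<in> ?C"
    by (simp add: topspace_eq)
  ultimately have "?C = {\<one>}"
    by blast
  then have "separated_between T {\<one>} J"
    using separated_between_quasi_component_compact[OF C closedin_compact_space[OF compact J(1)]] J(2)
    by (simp add: disjnt_def)
  then obtain D where "closedin T D" "openin T D" "\<one> \<in> D" "J \<subseteq> topspace T - D"
    by (auto simp: separated_between)
  then show ?thesis
    using open_subgroup_in_clopen[of D] that by (metis DiffD2 Int_emptyI subsetD)
qed

end

section \<open>Cochains on a quotient group\<close>

locale closed_normal_subgroup = profinite_group S T for S :: "'s monoid" (structure) and T +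
  fixes N :: "'s set"
  assumes normal_N: "N \<lhd> S" and closed_N: "closedin T N"
begin

declare mult_FactGroup [simp del]

abbreviation "Q \<equiv> S Mod N"
abbreviation "TQ \<equiv> quotient_topology S T N"
abbreviation proj :: "'s \<Rightarrow> 's set" ("\<pi>") where "\<pi> x \<equiv> N #> x"

lemma subgroup_N: "subgroup N S"
  using normal_N by (rule normal_imp_subgroup)

lemma N_closed: "x \<in> N \<Longrightarrow> x \<in> carrier S"
  using subgroup.mem_carrier[OF subgroup_N] .

lemma conj_closed: "x \<in> carrier S \<Longrightarrow> \<nu> \<in> N \<Longrightarrow> inv x \<otimes> \<nu> \<otimes> x \<in> N"
  using normal.inv_op_closed1[OF normal_N] .

lemma carrier_Q: "carrier Q = \<pi> ` carrier S"
  by (auto simp: FactGroup_def RCOSETS_def)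

lemma proj_closed: "x \<in> carrier S \<Longrightarrow> \<pi> x \<in> carrier Q"
  by (simp add: carrier_Q)

lemma proj_mult: "x \<in> carrier S \<Longrightarrow> y \<in> carrier S \<Longrightarrow> \<pi> x \<otimes>\<^bsub>Q\<^esub> \<pi> y = \<pi> (x \<otimes> y)"
  by (simp add: FactGroup_def normal.rcos_sum[OF normal_N])

lemma proj_N: "\<nu> \<in> N \<Longrightarrow> \<pi> \<nu> = N"
  using coset_join2[OF N_closed subgroup_N] by simp

lemma proj_eqD:
  assumes "\<pi> x = \<pi> y" "x \<in> carrier S" "y \<in> carrier S"
  obtains \<nu> where "\<nu> \<in> N" "x = y \<otimes> \<nu>"
proof -
  have "x \<in> N #> y"
    using rcos_self[OF assms(2) subgroup_N] assms(1) by simp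
  then have "x \<in> y <# N"
    using normal.coset_eq[OF normal_N] assms(3) by simp
  then show ?thesis
    using that by (auto simp: l_coset_def)
qed

lemma topspace_TQ: "topspace TQ = carrier Q"
proof -
  have "{x \<in> topspace T. \<pi> x \<in> carrier Q} = topspace T"
    by (auto simp: topspace_eq proj_closed)
  then have "openin TQ (carrier Q)"
    by (simp add: openin_quotient_topology)
  moreover have "topspace TQ \<subseteq> carrier Q"
    using openin_topspace[of TQ] unfolding openin_quotient_topology[of S T N] by (rule conjunct1)
  ultimately show ?thesis
    using openin_subset by blast
qed

lemma continuous_proj: "continuous_map T TQ \<pi>"
  by (auto simp: continuous_map_def topspace_TQ topspace_eq proj_closed openin_quotient_topology)

lemma openin_proj:
  assumes U: "openin T U"
  shows "openin TQ (\<pi> ` U)"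
proof -
  have US: "U \<subseteq> carrier S"
    using openin_subset[OF U] topspace_eq by simp
  have "{x \<in> topspace T. \<pi> x \<in> \<pi> ` U} = (\<Union>\<nu>\<in>N. {x \<in> carrier S. \<nu> \<otimes> x \<in> U})"
  proof (intro equalityI subsetI)
    fix x assume "x \<in> {x \<in> topspace T. \<pi> x \<in> \<pi> ` U}"
    then obtain u where x: "x \<in> carrier S" and u: "u \<in> U" "\<pi> x = \<pi> u"
      by (auto simp: topspace_eq)
    then have "u \<in> \<pi> x"
      using rcos_self[OF _ subgroup_N] US by blast
    then show "x \<in> (\<Union>\<nu>\<in>N. {x \<in> carrier S. \<nu> \<otimes> x \<in> U})"
      using x u(1) by (auto simp: r_coset_def)
  next
    fix x assume "x \<in> (\<Union>\<nu>\<in>N. {x \<in> carrier S. \<nu> \<otimes> x \<in> U})"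
    then obtain \<nu> where \<nu>: "\<nu> \<in> N" "x \<in> carrier S" "\<nu> \<otimes> x \<in> U"
      by blast
    have "\<pi> (\<nu> \<otimes> x) = \<pi> x"
      using \<nu> proj_mult[of \<nu> x] proj_mult[of \<one> x] proj_N[of \<nu>] proj_N[of \<one>] N_closed
        subgroup.one_closed[OF subgroup_N] by simp
    then show "x \<in> {x \<in> topspace T. \<pi> x \<in> \<pi> ` U}"
      using \<nu> by (metis (mono_tags, lifting) imageI mem_Collect_eq topspace_eq)
  qed
  moreover have "openin T (\<Union>\<nu>\<in>N. {x \<in> carrier S. \<nu> \<otimes> x \<in> U})"
    using openin_translate[OF U] N_closed by blast
  ultimately show ?thesis
    using US by (auto simp: openin_quotient_topology proj_closed)
qed

lemma deflate_C1:
  fixes z :: "'s \<Rightarrow> 'r::comm_ring_1"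
  assumes z: "continuous_map T (discrete_topology UNIV) z"
    and inv: "\<And>x \<nu>. x \<in> carrier S \<Longrightarrow> \<nu> \<in> N \<Longrightarrow> z (x \<otimes> \<nu>) = z x"
  obtains z' where "z' \<in> C1 Q TQ" "\<And>x. x \<in> carrier S \<Longrightarrow> z' (\<pi> x) = z x"
proof -
  define z' where "z' = restrict (\<lambda>P. z (SOME x. x \<in> carrier S \<and> \<pi> x = P)) (carrier Q)"
  have eq: "z' (\<pi> x) = z x" if x: "x \<in> carrier S" for x
  proof -
    define y where "y = (SOME y. y \<in> carrier S \<and> \<pi> y = \<pi> x)"
    have y: "y \<in> carrier S \<and> \<pi> y = \<pi> x"
      unfolding y_def by (rule someI[of _ x]) (simp add: x)
    then obtain \<nu> where "\<nu> \<in> N" "y = x \<otimes> \<nu>"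
      using proj_eqD x by blast
    then have "z y = z x"
      using inv x by simp
    then show ?thesis
      using x by (simp add: z'_def proj_closed y_def)
  qed
  moreover have "openin TQ {P \<in> topspace TQ. z' P \<in> W}" for W
  proof -
    have "{x \<in> topspace T. \<pi> x \<in> {P \<in> topspace TQ. z' P \<in> W}} = {x \<in> topspace T. z x \<in> W}"
      by (auto simp: topspace_eq topspace_TQ proj_closed eq)
    moreover have "openin T {x \<in> topspace T. z x \<in> W}"
      using z by (rule openin_continuous_map_preimage) simp
    ultimately show ?thesis
      by (auto simp: openin_quotient_topology topspace_TQ)
  qed
  then have "z' \<in> C1 Q TQ"
    by (simp add: C1_def continuous_map_def z'_def)
  ultimately show ?thesis
    using that by blast
qed

text \<open>A product of quotient maps need not be a quotient map; openness of \<open>\<pi>\<close>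
  is what brings continuity down to the product.\<close>

lemma continuous_on_Q_times_Q:
  assumes b: "continuous_map (prod_topology T T) (discrete_topology UNIV) (\<lambda>(x, y). b (\<pi> x, \<pi> y))"
  shows "continuous_map (prod_topology TQ TQ) (discrete_topology UNIV) b"
proof -
  have "openin (prod_topology TQ TQ) {p \<in> topspace (prod_topology TQ TQ). b p \<in> W}" for W
    unfolding openin_prod_topology_alt
  proof (intro allI impI)
    fix P P' assume "(P, P') \<in> {p \<in> topspace (prod_topology TQ TQ). b p \<in> W}"
    then obtain x x' where x: "x \<in> carrier S" "x' \<in> carrier S" "P = \<pi> x" "P' = \<pi> x'" "b (\<pi> x, \<pi> x') \<in> W"
      by (auto simp: topspace_TQ carrier_Q)
    have op: "openin (prod_topology T T) {p \<in> topspace (prod_topology T T). (\<lambda>(x, y). b (\<pi> x, \<pi> y)) p \<in> W}"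
      using b by (rule openin_continuous_map_preimage) simp
    have "(x, x') \<in> {p \<in> topspace (prod_topology T T). (\<lambda>(x, y). b (\<pi> x, \<pi> y)) p \<in> W}"
      using x by (simp add: topspace_eq)
    from op[unfolded openin_prod_topology_alt, rule_format, OF this]
    obtain U U' where U: "openin T U" "openin T U'" "x \<in> U" "x' \<in> U'"
      "U \<times> U' \<subseteq> {p \<in> topspace (prod_topology T T). (\<lambda>(x, y). b (\<pi> x, \<pi> y)) p \<in> W}"
      by (elim exE conjE)
    have "\<pi> ` U \<times> \<pi> ` U' \<subseteq> {p \<in> topspace (prod_topology TQ TQ). b p \<in> W}"
      using U(5) by (fastforce simp: topspace_eq topspace_TQ proj_closed)
    then show "\<exists>U V. openin TQ U \<and> openin TQ V \<and> P \<in> U \<and> P' \<in> V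
        \<and> U \<times> V \<subseteq> {p \<in> topspace (prod_topology TQ TQ). b p \<in> W}"
      by (intro exI[of _ "\<pi> ` U"] exI[of _ "\<pi> ` U'"] conjI openin_proj U(1,2))
        (simp_all add: x(3,4) U(3,4))
  qed
  then show ?thesis
    by (simp add: continuous_map_def)
qed

text \<open>The cocycle identity holds for the inflation because that is a coboundary on
  \<open>S\<close>, and it descends because \<open>\<pi>\<close> is onto.\<close>

lemma cocycle_of_inflation:
  fixes y :: "'s \<Rightarrow> 'r::comm_ring_1"
  assumes y: "continuous_map T (discrete_topology UNIV) y"
    and b: "b \<in> extensional (carrier Q \<times> carrier Q)"
    and eq: "\<And>x x'. x \<in> carrier S \<Longrightarrow> x' \<in> carrier S \<Longrightarrow> b (\<pi> x, \<pi> x') = y x + y x' - y (x \<otimes> x')"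
  shows "b \<in> carrier (Z2 Q TQ)"
proof -
  have "continuous_map (prod_topology T T) (discrete_topology UNIV) (\<lambda>p. y (fst p) + y (snd p) - y (fst p \<otimes> snd p))"
    using continuous_map_compose[OF continuous_map_fst y] continuous_map_compose[OF continuous_map_snd y]
      continuous_map_compose[OF continuous_mult y]
    by (intro continuous_map_discrete_arith) (simp_all add: o_def case_prod_unfold)
  then have "continuous_map (prod_topology T T) (discrete_topology UNIV) (\<lambda>(x, y). b (\<pi> x, \<pi> y))"
    by (rule continuous_map_eq) (auto simp: topspace_eq eq)
  then have "b \<in> C2 Q TQ"
    using b continuous_on_Q_times_Q by (simp add: C2_def)
  then show ?thesis
    by (auto simp: Z2_def carrier_Q proj_mult eq m_assoc)
qed

lemma H2_class_eq: "H2_class Q TQ b = {\<lambda>p\<in>carrier Q \<times> carrier Q. coboundary Q z p + b p | z. z \<in> C1 Q TQ}"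
  by (auto simp: H2_class_def r_coset_def Z2_def B2_def)

lemma C1_arith:
  assumes "z \<in> C1 Q TQ" "z' \<in> C1 Q TQ"
  shows "(\<lambda>p\<in>carrier Q. z p + z' p) \<in> C1 Q TQ" and "(\<lambda>p\<in>carrier Q. z p - z' p) \<in> C1 Q TQ"
proof -
  have "continuous_map TQ (discrete_topology UNIV) (\<lambda>p. z p + z' p)"
    "continuous_map TQ (discrete_topology UNIV) (\<lambda>p. z p - z' p)"
    using assms by (auto simp: C1_def intro: continuous_map_discrete_arith)
  then show "(\<lambda>p\<in>carrier Q. z p + z' p) \<in> C1 Q TQ" "(\<lambda>p\<in>carrier Q. z p - z' p) \<in> C1 Q TQ"
    by (auto simp: C1_def topspace_TQ elim!: continuous_map_eq)
qed

lemma Q_mult_closed: "P \<in> carrier Q \<Longrightarrow> P' \<in> carrier Q \<Longrightarrow> P \<otimes>\<^bsub>Q\<^esub> P' \<in> carrier Q"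
  by (auto simp: carrier_Q proj_mult)

text \<open>Shifting the coboundary part by \<open>z\<close> in either direction gives the two
  inclusions of cosets.\<close>

lemma H2_class_eqI:
  assumes b: "b \<in> extensional (carrier Q \<times> carrier Q)" "b' \<in> extensional (carrier Q \<times> carrier Q)"
    and z: "z \<in> C1 Q TQ"
    and eq: "\<And>p. p \<in> carrier Q \<times> carrier Q \<Longrightarrow> b' p = coboundary Q z p + b p"
  shows "H2_class Q TQ b = H2_class Q TQ b'"
proof (intro equalityI subsetI)
  fix h assume "h \<in> H2_class Q TQ b"
  then obtain u where u: "u \<in> C1 Q TQ" "h = (\<lambda>p\<in>carrier Q \<times> carrier Q. coboundary Q u p + b p)"
    by (auto simp: H2_class_eq)
  have "h = (\<lambda>p\<in>carrier Q \<times> carrier Q. coboundary Q (\<lambda>p\<in>carrier Q. u p - z p) p + b' p)"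
    unfolding u(2) by (intro restrict_ext) (auto simp: eq coboundary_def Q_mult_closed)
  then show "h \<in> H2_class Q TQ b'"
    using C1_arith(2)[OF u(1) z] unfolding H2_class_eq by blast
next
  fix h assume "h \<in> H2_class Q TQ b'"
  then obtain u where u: "u \<in> C1 Q TQ" "h = (\<lambda>p\<in>carrier Q \<times> carrier Q. coboundary Q u p + b' p)"
    by (auto simp: H2_class_eq)
  have "h = (\<lambda>p\<in>carrier Q \<times> carrier Q. coboundary Q (\<lambda>p\<in>carrier Q. u p + z p) p + b p)"
    unfolding u(2) by (intro restrict_ext) (auto simp: eq coboundary_def Q_mult_closed)
  then show "h \<in> H2_class Q TQ b"
    using C1_arith(1)[OF u(1) z] unfolding H2_class_eq by blast
qed

lemma H2_class_eqD:
  fixes b b' :: "'s set \<times> 's set \<Rightarrow> 'r::comm_ring_1"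
  assumes eq: "H2_class Q TQ b = H2_class Q TQ b'" and b': "b' \<in> extensional (carrier Q \<times> carrier Q)"
  obtains z where "z \<in> C1 Q TQ" "\<And>p. p \<in> carrier Q \<times> carrier Q \<Longrightarrow> b' p = coboundary Q z p + b p"
proof -
  have zero: "(\<lambda>p\<in>carrier Q. 0 :: 'r) \<in> C1 Q TQ"
    by (auto simp: C1_def topspace_TQ intro: continuous_map_eq[of _ _ "\<lambda>_. 0"])
  have "b' = (\<lambda>p\<in>carrier Q \<times> carrier Q. coboundary Q (\<lambda>p\<in>carrier Q. 0) p + b' p)"
    using b' by (auto simp: coboundary_def Q_mult_closed extensional_def restrict_def fun_eq_iff)
  then have "b' \<in> H2_class Q TQ b"
    unfolding eq using zero unfolding H2_class_eq by blast
  then show ?thesis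
    using that by (auto simp: H2_class_eq)
qed

end

section \<open>The transgression\<close>

context closed_normal_subgroup
begin

text \<open>The data in the description of \<open>trg\<close>, normalised at \<open>\<one>\<close>.
  The normalisation is automatic when \<open>y\<close> restricts to a homomorphism on
  \<open>N\<close>.\<close>

definition trg_cochain ::
  "('s \<Rightarrow> 'r::comm_ring_1) \<Rightarrow> ('s set \<times> 's set \<Rightarrow> 'r) \<Rightarrow> bool" where
  "trg_cochain y b \<longleftrightarrow> y \<in> C1 S T \<and> b \<in> carrier (Z2 Q TQ) \<and> y \<one> = 0 \<and>
     (\<forall>x\<in>carrier S. \<forall>x'\<in>carrier S. b (\<pi> x, \<pi> x') = y x + y x' - y (x \<otimes> x'))"

context
  fixes y :: "'s \<Rightarrow> 'r::comm_ring_1" and b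
  assumes cochain: "trg_cochain y b"
begin

lemma trg_cochain_continuous: "continuous_map T (discrete_topology UNIV) y"
  using cochain by (simp add: trg_cochain_def C1_def)

lemma trg_cochain_extensional: "b \<in> extensional (carrier Q \<times> carrier Q)"
  using cochain by (simp add: trg_cochain_def Z2_def C2_def)

lemma trg_cochain_eq:
  "x \<in> carrier S \<Longrightarrow> x' \<in> carrier S \<Longrightarrow> b (\<pi> x, \<pi> x') = y x + y x' - y (x \<otimes> x')"
  using cochain by (simp add: trg_cochain_def)

lemma trg_cochain_one: "y \<one> = 0"
  using cochain by (simp add: trg_cochain_def)

text \<open>Since \<open>\<nu>\<close> and \<open>\<one>\<close> have the same image in
  \<open>Q\<close>, the value of \<open>b\<close> at \<open>(\<pi> x, \<pi> \<nu>)\<close> is that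
  at \<open>(\<pi> x, \<pi> \<one>)\<close>, namely \<open>y \<one> = 0\<close>.\<close>

lemma trg_cochain_mult_N:
  assumes "x \<in> carrier S" "\<nu> \<in> N"
  shows "y (x \<otimes> \<nu>) = y x + y \<nu>" and "y (\<nu> \<otimes> x) = y \<nu> + y x"
proof -
  have "\<pi> \<nu> = \<pi> \<one>"
    using assms(2) proj_N subgroup.one_closed[OF subgroup_N] by simp
  then have "b (\<pi> x, \<pi> \<nu>) = 0" "b (\<pi> \<nu>, \<pi> x) = 0"
    using assms(1) trg_cochain_eq[of x \<one>] trg_cochain_eq[of \<one> x] trg_cochain_one by simp_all
  then show "y (x \<otimes> \<nu>) = y x + y \<nu>" "y (\<nu> \<otimes> x) = y \<nu> + y x"
    using assms trg_cochain_eq[of x \<nu>] trg_cochain_eq[of \<nu> x] N_closed by simp_all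
qed

lemma trg_cochain_restrict: "restrict y N \<in> H1_invariant S T N"
proof -
  have "continuous_map (subtopology T N) (discrete_topology UNIV) (restrict y N)"
    by (rule continuous_map_eq[OF continuous_map_from_subtopology[OF trg_cochain_continuous]])
       simp
  moreover have "y (inv x \<otimes> \<nu> \<otimes> x) = y \<nu>" if "x \<in> carrier S" "\<nu> \<in> N" for x \<nu>
  proof -
    have "x \<otimes> (inv x \<otimes> \<nu> \<otimes> x) = \<nu> \<otimes> x"
      using that N_closed by (simp flip: m_assoc)
    then have "y x + y (inv x \<otimes> \<nu> \<otimes> x) = y \<nu> + y x"
      using that trg_cochain_mult_N(1)[OF that(1) conj_closed[OF that]] trg_cochain_mult_N(2)[OF that]
      by simp
    then show ?thesis
      by simp
  qed
  ultimately show ?thesis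
    using trg_cochain_mult_N N_closed subgroup.m_closed[OF subgroup_N]
    by (auto simp: H1_invariant_def H1_def C1_def coboundary_def conj_closed)
qed

end

text \<open>Well-definedness of the transgression: \<open>y' - y\<close> is invariant under
  translation by \<open>N\<close> and descends to a cochain on \<open>Q\<close>, whose coboundary is
  the difference of the cocycles.\<close>

lemma trg_cochain_class_unique:
  assumes y: "trg_cochain y b" and y': "trg_cochain y' b'" and eq: "restrict y N = restrict y' N"
  shows "H2_class Q TQ b = H2_class Q TQ b'"
proof -
  let ?z = "\<lambda>x. y' x - y x"
  have cont: "continuous_map T (discrete_topology UNIV) ?z"
    using trg_cochain_continuous[OF y'] trg_cochain_continuous[OF y] by (rule continuous_map_discrete_arith)
  have inv: "?z (x \<otimes> \<nu>) = ?z x" if "x \<in> carrier S" "\<nu> \<in> N" for x \<nu>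
    using that trg_cochain_mult_N[OF y that] trg_cochain_mult_N[OF y' that] fun_cong[OF eq, of \<nu>] by simp
  obtain z where z: "z \<in> C1 Q TQ" "\<And>x. x \<in> carrier S \<Longrightarrow> z (\<pi> x) = ?z x"
    using deflate_C1[of ?z, OF cont inv] by metis
  show ?thesis
  proof (rule H2_class_eqI[OF trg_cochain_extensional[OF y] trg_cochain_extensional[OF y'] z(1)])
    show "b' p = coboundary Q z p + b p" if "p \<in> carrier Q \<times> carrier Q" for p
      using that
      by (auto simp: carrier_Q coboundary_def proj_mult z(2) trg_cochain_eq[OF y] trg_cochain_eq[OF y'])
  qed
qed

text \<open>Exactness of the five-term sequence at H^1(N)^S: a cochain \<open>z\<close> bounding the
  difference of the cocycles corrects \<open>y' - y\<close> to a homomorphism on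
  \<open>S\<close>.\<close>

lemma trg_cochain_class_eqD:
  assumes y: "trg_cochain y b" and y': "trg_cochain y' b'" and eq: "H2_class Q TQ b = H2_class Q TQ b'"
  obtains g where "continuous_map T (discrete_topology UNIV) g"
    and "\<And>x x'. x \<in> carrier S \<Longrightarrow> x' \<in> carrier S \<Longrightarrow> g (x \<otimes> x') = g x + g x'"
    and "\<And>\<nu>. \<nu> \<in> N \<Longrightarrow> g \<nu> = y' \<nu> - y \<nu>"
proof -
  obtain z where z: "z \<in> C1 Q TQ" and b': "\<And>p. p \<in> carrier Q \<times> carrier Q \<Longrightarrow> b' p = coboundary Q z p + b p"
    using H2_class_eqD[OF eq trg_cochain_extensional[OF y']] by blast
  have z_eq: "z (\<pi> x) + z (\<pi> x') - z (\<pi> (x \<otimes> x')) = (y' x + y' x' - y' (x \<otimes> x')) - (y x + y x' - y (x \<otimes> x'))"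
    if "x \<in> carrier S" "x' \<in> carrier S" for x x'
    using that b'[of "(\<pi> x, \<pi> x')"] trg_cochain_eq[OF y that] trg_cochain_eq[OF y' that]
    by (simp add: coboundary_def proj_closed proj_mult)
  \<comment> \<open>At \<open>(\<one>, \<one>)\<close> the identity \<open>z_eq\<close> reduces to
    \<open>z (\<pi> \<one>) = 0\<close>, since both cochains are normalised.\<close>
  have z_N: "z (\<pi> \<nu>) = 0" if "\<nu> \<in> N" for \<nu>
    using z_eq[of \<one> \<one>] trg_cochain_one[OF y] trg_cochain_one[OF y'] that
      proj_N[of \<nu>] proj_N[of \<one>] subgroup.one_closed[OF subgroup_N] by simp
  have "continuous_map T (discrete_topology UNIV) (\<lambda>x. z (\<pi> x))"
    using continuous_map_compose[OF continuous_proj, of _ z] z by (simp add: C1_def o_def)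
  then have "continuous_map T (discrete_topology UNIV) (\<lambda>x. y' x - y x - z (\<pi> x))"
    using trg_cochain_continuous[OF y] trg_cochain_continuous[OF y']
    by (intro continuous_map_discrete_arith)
  moreover have "y' (x \<otimes> x') - y (x \<otimes> x') - z (\<pi> (x \<otimes> x')) =
      (y' x - y x - z (\<pi> x)) + (y' x' - y x' - z (\<pi> x'))"
    if "x \<in> carrier S" "x' \<in> carrier S" for x x'
    using z_eq[OF that] by (simp add: algebra_simps)
  ultimately show ?thesis
    using that z_N by simp
qed

lemma trg_eq:
  assumes y: "trg_cochain y b"
  shows "trg S T N (restrict y N) = H2_class Q TQ b"
  unfolding trg_def
proof (rule the_equality)
  show "\<exists>y'\<in>C1 S T. \<exists>b'\<in>carrier (Z2 Q TQ). restrict y' N = restrict y N \<and>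
      (\<forall>\<sigma>\<in>carrier S. \<forall>\<tau>\<in>carrier S. coboundary S y' (\<sigma>, \<tau>) = b' (\<pi> \<sigma>, \<pi> \<tau>)) \<and>
      H2_class Q TQ b = H2_class Q TQ b'"
    using y by (intro bexI[of _ y] bexI[of _ b]) (auto simp: trg_cochain_def coboundary_def)
next
  fix \<alpha>
  assume "\<exists>y'\<in>C1 S T. \<exists>b'\<in>carrier (Z2 Q TQ). restrict y' N = restrict y N \<and>
      (\<forall>\<sigma>\<in>carrier S. \<forall>\<tau>\<in>carrier S. coboundary S y' (\<sigma>, \<tau>) = b' (\<pi> \<sigma>, \<pi> \<tau>)) \<and>
      \<alpha> = H2_class Q TQ b'"
  then obtain y' b' where y': "y' \<in> C1 S T" "b' \<in> carrier (Z2 Q TQ)" "restrict y' N = restrict y N"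
      "\<forall>\<sigma>\<in>carrier S. \<forall>\<tau>\<in>carrier S. coboundary S y' (\<sigma>, \<tau>) = b' (\<pi> \<sigma>, \<pi> \<tau>)" "\<alpha> = H2_class Q TQ b'"
    by blast
  \<comment> \<open>The description of \<open>trg\<close> does not ask for normalised cochains, but
    \<open>\<one>\<close> lies in \<open>N\<close>, where \<open>y'\<close> and \<open>y\<close>
    agree.\<close>
  have "y' \<one> = y \<one>"
    using fun_cong[OF y'(3), of \<one>] subgroup.one_closed[OF subgroup_N] by simp
  then have "trg_cochain y' b'"
    using y' trg_cochain_one[OF y] by (auto simp: trg_cochain_def coboundary_def)
  from trg_cochain_class_unique[OF this y y'(3)] show "\<alpha> = H2_class Q TQ b"
    using y'(5) by simp
qed

text \<open>
  Choose an open subgroup \<open>V\<close> such that \<open>f\<close> vanishes on \<open>N \<inter> V\<close>.  Then \<open>f\<close> extends to \<open>N V\<close> by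
  \<open>\<nu> v \<mapsto> f \<nu>\<close>, and to \<open>S\<close> by means of representatives of the left cosets of \<open>N V\<close>.
\<close>

lemma extend_equivariantly:
  fixes f :: "'s \<Rightarrow> 'r::comm_ring_1"
  assumes f: "f \<in> H1_invariant S T N"
  obtains y where "continuous_map T (discrete_topology UNIV) y"
    and "\<And>x \<nu>. x \<in> carrier S \<Longrightarrow> \<nu> \<in> N \<Longrightarrow> y (x \<otimes> \<nu>) = y x + f \<nu>" and "y \<one> = 0"
proof -
  have f_mult: "f (\<nu> \<otimes> \<nu>') = f \<nu> + f \<nu>'" if "\<nu> \<in> N" "\<nu>' \<in> N" for \<nu> \<nu>'
    using f that by (auto simp: H1_invariant_def H1_def coboundary_def)
  have f_inv: "f (inv x \<otimes> \<nu> \<otimes> x) = f \<nu>" if "x \<in> carrier S" "\<nu> \<in> N" for x \<nu>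
    using f that by (auto simp: H1_invariant_def)
  have one_N: "\<one> \<in> N"
    using subgroup.one_closed[OF subgroup_N] .
  have f_one: "f \<one> = 0"
    using f_mult[OF one_N one_N] by simp
  have NS: "N \<subseteq> carrier S"
    using N_closed by blast
  have "continuous_map (subtopology T N) (discrete_topology UNIV) f"
    using f by (simp add: H1_invariant_def H1_def C1_def)
  then have "closedin (subtopology T N) {\<nu> \<in> topspace (subtopology T N). f \<nu> \<in> - {0}}"
    by (rule closedin_continuous_map_preimage) simp
  then have "closedin T {\<nu> \<in> topspace (subtopology T N). f \<nu> \<in> - {0}}"
    using closed_N closedin_trans_full by blast
  moreover have "{\<nu> \<in> topspace (subtopology T N). f \<nu> \<in> - {0}} = {\<nu> \<in> N. f \<nu> \<noteq> 0}"
    using NS by (auto simp: topspace_eq)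
  ultimately have "closedin T {\<nu> \<in> N. f \<nu> \<noteq> 0}"
    by simp
  moreover have "\<one> \<notin> {\<nu> \<in> N. f \<nu> \<noteq> 0}"
    using f_one by simp
  ultimately obtain V where V: "subgroup V S" "openin T V" and "V \<inter> {\<nu> \<in> N. f \<nu> \<noteq> 0} = {}"
    by (rule open_subgroup_avoiding)
  then have f_V: "f \<nu> = 0" if "\<nu> \<in> N" "\<nu> \<in> V" for \<nu>
    using that by blast
  have V_closed: "v \<in> carrier S" if "v \<in> V" for v
    using subgroup.mem_carrier[OF V(1) that] .
  define H where "H = N <#> V"
  have H: "subgroup H S"
    unfolding H_def by (rule mult_norm_subgroup[OF normal_N V(1)])
  have H_iff: "z \<in> H \<longleftrightarrow> (\<exists>\<nu>\<in>N. \<exists>v\<in>V. z = \<nu> \<otimes> v)" for z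
    by (auto simp: H_def set_mult_def)
  define F where "F z = f (SOME \<nu>. \<nu> \<in> N \<and> (\<exists>v\<in>V. z = \<nu> \<otimes> v))" for z
  \<comment> \<open>The \<open>N\<close>-parts of two decompositions differ by an element of both
    \<open>N\<close> and \<open>V\<close>, where \<open>f\<close> vanishes.\<close>
  have F: "F (\<nu> \<otimes> v) = f \<nu>" if \<nu>: "\<nu> \<in> N" and v: "v \<in> V" for \<nu> v
  proof -
    define \<mu> where "\<mu> = (SOME \<mu>. \<mu> \<in> N \<and> (\<exists>u\<in>V. \<nu> \<otimes> v = \<mu> \<otimes> u))"
    have "\<mu> \<in> N \<and> (\<exists>u\<in>V. \<nu> \<otimes> v = \<mu> \<otimes> u)"
      unfolding \<mu>_def by (rule someI[of _ \<nu>]) (use \<nu> v in blast)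
    then obtain u where \<mu>: "\<mu> \<in> N" and u: "u \<in> V" and eq: "\<nu> \<otimes> v = \<mu> \<otimes> u"
      by blast
    have "inv \<mu> \<otimes> \<nu> = inv \<mu> \<otimes> (\<nu> \<otimes> v) \<otimes> inv v"
      using \<nu> v \<mu> NS V_closed by (simp add: m_assoc subset_iff)
    also have "\<dots> = u \<otimes> inv v"
      unfolding eq using \<mu> u v NS V_closed by (simp add: subset_iff flip: m_assoc)
    finally have "inv \<mu> \<otimes> \<nu> \<in> V"
      using subgroup.m_closed[OF V(1) u subgroup.m_inv_closed[OF V(1) v]] by simp
    moreover have inv\<mu>: "inv \<mu> \<in> N"
      using subgroup.m_inv_closed[OF subgroup_N \<mu>] .
    ultimately have "f (inv \<mu> \<otimes> \<nu>) = 0"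
      using f_V subgroup.m_closed[OF subgroup_N inv\<mu> \<nu>] by blast
    moreover have "f (inv \<mu> \<otimes> \<mu>) = 0"
      using \<mu> NS f_one by (simp add: subset_iff)
    ultimately have "f \<mu> = f \<nu>"
      using f_mult[OF inv\<mu> \<nu>] f_mult[OF inv\<mu> \<mu>] by (simp add: add_eq_0_iff)
    then show ?thesis
      by (simp add: F_def \<mu>_def)
  qed
  have F_V: "F (z \<otimes> u) = F z" if z: "z \<in> H" and u: "u \<in> V" for z u
  proof -
    obtain \<nu> v where \<nu>: "\<nu> \<in> N" and v: "v \<in> V" and z_eq: "z = \<nu> \<otimes> v"
      using z by (auto simp: H_iff)
    have "z \<otimes> u = \<nu> \<otimes> (v \<otimes> u)"
      using \<nu> v u NS V_closed by (simp add: z_eq m_assoc subset_iff)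
    then show ?thesis
      using F[OF \<nu> subgroup.m_closed[OF V(1) v u]] F[OF \<nu> v] z_eq by simp
  qed
  \<comment> \<open>Moving \<open>\<mu>\<close> to the left of \<open>v\<close> conjugates it, which
    invariance of \<open>f\<close> does not notice.\<close>
  have F_N: "F (z \<otimes> \<mu>) = F z + f \<mu>" if z: "z \<in> H" and \<mu>: "\<mu> \<in> N" for z \<mu>
  proof -
    obtain \<nu> v where \<nu>: "\<nu> \<in> N" and v: "v \<in> V" and z_eq: "z = \<nu> \<otimes> v"
      using z by (auto simp: H_iff)
    have conj: "v \<otimes> \<mu> \<otimes> inv v \<in> N" "f (v \<otimes> \<mu> \<otimes> inv v) = f \<mu>"
      using conj_closed[of "inv v" \<mu>] f_inv[of "inv v" \<mu>] V_closed[OF v] \<mu> by simp_all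
    have "z \<otimes> \<mu> = (\<nu> \<otimes> (v \<otimes> \<mu> \<otimes> inv v)) \<otimes> v"
      using \<nu> v \<mu> NS V_closed by (simp add: z_eq m_assoc subset_iff)
    then show ?thesis
      using F[OF subgroup.m_closed[OF subgroup_N \<nu> conj(1)] v] F[OF \<nu> v] f_mult[OF \<nu> conj(1)] conj(2) z_eq
      by simp
  qed
  have NH: "\<nu> \<in> H" if "\<nu> \<in> N" for \<nu>
    unfolding H_iff using that N_closed subgroup.one_closed[OF V(1)]
    by (intro bexI[where x = \<nu>] bexI[where x = \<one>]) simp_all
  have VH: "v \<in> H" if "v \<in> V" for v
    unfolding H_iff using that V_closed one_N
    by (intro bexI[where x = \<one>] bexI[where x = v]) simp_all
  \<comment> \<open>The choice refers to the coset and not to \<open>x\<close>, so \<open>s\<close>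
    is constant on left cosets of \<open>H\<close>.\<close>
  define s where "s x = (SOME t. t \<in> x <# H)" for x
  have s: "s x \<in> x <# H" if "x \<in> carrier S" for x
    unfolding s_def by (rule someI[of _ x])
      (use that subgroup.one_closed[OF H] in \<open>force simp: l_coset_def\<close>)
  have s_carrier: "s x \<in> carrier S" if "x \<in> carrier S" for x
    using s[OF that] that subgroup.mem_carrier[OF H] by (auto simp: l_coset_def)
  have s_H: "inv (s x) \<otimes> x \<in> H" if x: "x \<in> carrier S" for x
  proof -
    obtain h where h: "h \<in> H" "s x = x \<otimes> h"
      using s[OF x] by (auto simp: l_coset_def)
    then have "inv (s x) \<otimes> x = inv h"
      using x subgroup.mem_carrier[OF H] by (simp add: inv_mult_group m_assoc)
    then show ?thesis
      using subgroup.m_inv_closed[OF H h(1)] by simp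
  qed
  have s_mult: "s (x \<otimes> h) = s x" if x: "x \<in> carrier S" and h: "h \<in> H" for x h
  proof -
    have "x \<otimes> h \<in> x <# H"
      using h by (auto simp: l_coset_def)
    then have "x <# H = (x \<otimes> h) <# H"
      using l_repr_independence[OF _ x H] by blast
    then show ?thesis
      by (simp add: s_def)
  qed
  define y where "y x = F (inv (s x) \<otimes> x)" for x
  have y_V: "y (x \<otimes> v) = y x" if "x \<in> carrier S" "v \<in> V" for x v
    using that F_V[OF s_H[OF that(1)] that(2)] s_mult[OF that(1) VH[OF that(2)]] s_carrier V_closed
    by (simp add: y_def m_assoc)
  have y_N: "y (x \<otimes> \<nu>) = y x + f \<nu>" if "x \<in> carrier S" "\<nu> \<in> N" for x \<nu>
    using that F_N[OF s_H[OF that(1)] that(2)] s_mult[OF that(1) NH[OF that(2)]] s_carrier N_closed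
    by (simp add: y_def m_assoc)
  \<comment> \<open>\<open>y\<close> is constant on the open cosets of \<open>V\<close>.\<close>
  have y_cont: "continuous_map T (discrete_topology UNIV) y"
  proof -
    have "openin T {x \<in> topspace T. y x \<in> W}" for W
    proof (subst openin_subopen, intro ballI)
      fix x assume "x \<in> {x \<in> topspace T. y x \<in> W}"
      then have x: "x \<in> carrier S" "y x \<in> W"
        by (auto simp: topspace_eq)
      let ?U = "{z \<in> carrier S. inv x \<otimes> z \<in> V}"
      have "openin T ?U"
        using V(2) x(1) by (intro openin_translate) simp_all
      moreover have "x \<in> ?U"
        using x(1) subgroup.one_closed[OF V(1)] by simp
      moreover have "?U \<subseteq> {x \<in> topspace T. y x \<in> W}"
      proof
        fix z assume z: "z \<in> ?U"
        then have "x \<otimes> (inv x \<otimes> z) = z"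
          using x(1) by (simp flip: m_assoc)
        then show "z \<in> {x \<in> topspace T. y x \<in> W}"
          using z x y_V[OF x(1), of "inv x \<otimes> z"] by (simp add: topspace_eq)
      qed
      ultimately show "\<exists>U. openin T U \<and> x \<in> U \<and> U \<subseteq> {x \<in> topspace T. y x \<in> W}"
        by blast
    qed
    then show ?thesis
      by (simp add: continuous_map_def)
  qed
  \<comment> \<open>The representative \<open>s \<one>\<close> need not be \<open>\<one>\<close>;
    subtracting a constant normalises \<open>y\<close> and keeps it equivariant.\<close>
  have "continuous_map T (discrete_topology UNIV) (\<lambda>x. y x - y \<one>)"
    using y_cont by (rule continuous_map_discrete_comp)
  moreover have "y (x \<otimes> \<nu>) - y \<one> = (y x - y \<one>) + f \<nu>" if "x \<in> carrier S" "\<nu> \<in> N" for x \<nu>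
    using y_N[OF that] by simp
  ultimately show ?thesis
    using that by simp
qed

lemma trg_cochain_exists:
  assumes f: "f \<in> H1_invariant S T N"
  obtains y b where "trg_cochain y b" "restrict y N = f"
proof -
  obtain y0 where cont: "continuous_map T (discrete_topology UNIV) y0"
    and eqv: "\<And>x \<nu>. x \<in> carrier S \<Longrightarrow> \<nu> \<in> N \<Longrightarrow> y0 (x \<otimes> \<nu>) = y0 x + f \<nu>" and one: "y0 \<one> = 0"
    by (rule extend_equivariantly[OF f]) blast
  have f_mult: "f (\<nu> \<otimes> \<nu>') = f \<nu> + f \<nu>'" if "\<nu> \<in> N" "\<nu>' \<in> N" for \<nu> \<nu>'
    using f that by (auto simp: H1_invariant_def H1_def coboundary_def)
  have f_inv: "f (inv x \<otimes> \<nu> \<otimes> x) = f \<nu>" if "x \<in> carrier S" "\<nu> \<in> N" for x \<nu>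
    using f that by (auto simp: H1_invariant_def)
  define y where "y = restrict y0 (carrier S)"
  define d where "d x x' = y0 x + y0 x' - y0 (x \<otimes> x')" for x x'
  \<comment> \<open>Collecting the factors from \<open>N\<close> on the right conjugates
    \<open>\<nu>\<close> by \<open>x'\<close>. By invariance \<open>y0\<close> of the product grows
    by \<open>f \<nu> + f \<nu>'\<close>, as does the sum of the two values, so the coboundary
    descends to \<open>Q\<close>.\<close>
  have d: "d (x \<otimes> \<nu>) (x' \<otimes> \<nu>') = d x x'"
    if "x \<in> carrier S" "x' \<in> carrier S" "\<nu> \<in> N" "\<nu>' \<in> N" for x x' \<nu> \<nu>'
  proof -
    have closed: "\<nu> \<in> carrier S" "\<nu>' \<in> carrier S" "inv x' \<otimes> \<nu> \<otimes> x' \<in> carrier S"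
      using that N_closed by simp_all
    have conj: "x' \<otimes> (inv x' \<otimes> \<nu> \<otimes> x') = \<nu> \<otimes> x'"
      using that closed by (simp flip: m_assoc)
    have "x \<otimes> x' \<otimes> ((inv x' \<otimes> \<nu> \<otimes> x') \<otimes> \<nu>') = x \<otimes> (x' \<otimes> (inv x' \<otimes> \<nu> \<otimes> x')) \<otimes> \<nu>'"
      using that(1,2) closed(2,3) by (simp only: m_assoc m_closed)
    then have "x \<otimes> \<nu> \<otimes> (x' \<otimes> \<nu>') = x \<otimes> x' \<otimes> ((inv x' \<otimes> \<nu> \<otimes> x') \<otimes> \<nu>')"
      using that(1,2) closed(1,2) unfolding conj by (simp add: m_assoc)
    moreover have "(inv x' \<otimes> \<nu> \<otimes> x') \<otimes> \<nu>' \<in> N"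
      using subgroup.m_closed[OF subgroup_N conj_closed[OF that(2,3)] that(4)] .
    ultimately have "y0 (x \<otimes> \<nu> \<otimes> (x' \<otimes> \<nu>')) = y0 (x \<otimes> x') + f ((inv x' \<otimes> \<nu> \<otimes> x') \<otimes> \<nu>')"
      using eqv[OF m_closed[OF that(1,2)]] by presburger
    also have "f ((inv x' \<otimes> \<nu> \<otimes> x') \<otimes> \<nu>') = f \<nu> + f \<nu>'"
      unfolding f_mult[OF conj_closed[OF that(2,3)] that(4)] f_inv[OF that(2,3)] ..
    finally have "y0 (x \<otimes> \<nu> \<otimes> (x' \<otimes> \<nu>')) = y0 (x \<otimes> x') + (f \<nu> + f \<nu>')" .
    then show ?thesis
      using that eqv by (simp add: d_def)
  qed
  define rep where "rep P = (SOME x. x \<in> carrier S \<and> \<pi> x = P)" for P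
  define b where "b = restrict (\<lambda>(P, P'). d (rep P) (rep P')) (carrier Q \<times> carrier Q)"
  have b_eq: "b (\<pi> x, \<pi> x') = d x x'" if x: "x \<in> carrier S" and x': "x' \<in> carrier S" for x x'
  proof -
    have rep: "\<exists>\<nu>\<in>N. rep (\<pi> x) = x \<otimes> \<nu>" if "x \<in> carrier S" for x
    proof -
      have "rep (\<pi> x) \<in> carrier S \<and> \<pi> (rep (\<pi> x)) = \<pi> x"
        unfolding rep_def by (rule someI[of _ x]) (simp add: that)
      then obtain \<nu> where "\<nu> \<in> N" "rep (\<pi> x) = x \<otimes> \<nu>"
        using proj_eqD[of "rep (\<pi> x)" x] \<open>x \<in> carrier S\<close> by metis
      then show ?thesis
        by (rule bexI[rotated])
    qed
    obtain \<nu> where \<nu>: "\<nu> \<in> N" "rep (\<pi> x) = x \<otimes> \<nu>"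
      using rep[OF x] ..
    obtain \<nu>' where "\<nu>' \<in> N" "rep (\<pi> x') = x' \<otimes> \<nu>'"
      using rep[OF x'] ..
    with \<nu> show ?thesis
      using x x' d by (simp add: b_def proj_closed)
  qed
  have y_cont: "continuous_map T (discrete_topology UNIV) y"
    using cont by (rule continuous_map_eq) (simp add: y_def topspace_eq)
  have b_y: "b (\<pi> x, \<pi> x') = y x + y x' - y (x \<otimes> x')" if "x \<in> carrier S" "x' \<in> carrier S" for x x'
    using that by (simp add: b_eq d_def y_def)
  have "b \<in> carrier (Z2 Q TQ)"
    using y_cont b_y by (intro cocycle_of_inflation[of y]) (simp_all add: b_def)
  then have "trg_cochain y b"
    using y_cont b_y one by (simp add: trg_cochain_def C1_def y_def)
  moreover have "restrict y N = f"
  proof (rule extensionalityI[of _ N])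
    show "f \<in> extensional N"
      using f by (simp add: H1_invariant_def H1_def C1_def)
    show "restrict y N \<nu> = f \<nu>" if "\<nu> \<in> N" for \<nu>
      using that eqv[of \<one> \<nu>] one N_closed by (simp add: y_def)
  qed simp
  ultimately show ?thesis
    by (rule that)
qed

end

lemma (in free_profinite_group) inj_on_trg:
  fixes N :: "'s set"
  assumes N: "N \<lhd> S" "closedin T N" and n: "n \<ge> 2"
    and sub: "N \<subseteq> magnus_filtration A S T \<iota> TYPE('r::{finite,comm_ring_1}) n"
  shows "inj_on (trg S T N :: ('s \<Rightarrow> 'r) \<Rightarrow> _) (H1_invariant S T N)"
proof (rule inj_onI)
  interpret closed_normal_subgroup S T N
    by (intro closed_normal_subgroup.intro closed_normal_subgroup_axioms.intro profinite_group_axioms N)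
  fix f f' :: "'s \<Rightarrow> 'r"
  assume f: "f \<in> H1_invariant S T N" and f': "f' \<in> H1_invariant S T N" and eq: "trg S T N f = trg S T N f'"
  obtain y b where y: "trg_cochain y b" "restrict y N = f"
    by (rule trg_cochain_exists[OF f])
  obtain y' b' where y': "trg_cochain y' b'" "restrict y' N = f'"
    by (rule trg_cochain_exists[OF f'])
  have "H2_class Q TQ b = H2_class Q TQ b'"
    using eq trg_eq[OF y(1)] trg_eq[OF y'(1)] y(2) y'(2) by simp
  then obtain g where g: "continuous_map T (discrete_topology UNIV) g"
      "\<And>x x'. x \<in> carrier S \<Longrightarrow> x' \<in> carrier S \<Longrightarrow> g (x \<otimes> x') = g x + g x'"
      "\<And>\<nu>. \<nu> \<in> N \<Longrightarrow> g \<nu> = y' \<nu> - y \<nu>"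
    using trg_cochain_class_eqD[OF y(1) y'(1)] by metis
  have "y \<nu> = y' \<nu>" if "\<nu> \<in> N" for \<nu>
    using additive_vanishes_on_filtration[OF g(1,2) n, of \<nu>] g(3)[OF that] sub that by auto
  then show "f = f'"
    unfolding y(2)[symmetric] y'(2)[symmetric] by (intro restrict_ext) simp
qed

section \<open>The pairing\<close>

context closed_normal_subgroup
begin

text \<open>Powers are killed because \<open>m\<close> is 0 in the coefficients, commutators by
  invariance, and the closure because the zero set is closed in \<open>T\<close>. Hence
  \<open>f\<close> is constant on cosets; the second claim shows that a coset contains its
  representative.\<close>

lemma H1_invariant_vanishes:
  fixes f :: "'s \<Rightarrow> 'r::comm_ring_1"
  assumes f: "f \<in> H1_invariant S T N" and m: "(of_nat m :: 'r) = 0"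
  shows "powers_commutators S T N m \<subseteq> {\<nu> \<in> N. f \<nu> = 0}" and "\<one> \<in> powers_commutators S T N m"
proof -
  let ?D = "{\<nu> \<in> N. f \<nu> = 0}"
  let ?gen = "{\<nu> [^] m | \<nu>. \<nu> \<in> N} \<union>
      {inv \<sigma> \<otimes> inv \<nu> \<otimes> \<sigma> \<otimes> \<nu> | \<sigma> \<nu>. \<sigma> \<in> carrier S \<and> \<nu> \<in> N}"
  have f_mult: "f (\<nu> \<otimes> \<nu>') = f \<nu> + f \<nu>'" if "\<nu> \<in> N" "\<nu>' \<in> N" for \<nu> \<nu>'
    using f that by (auto simp: H1_invariant_def H1_def coboundary_def)
  have f_conj: "f (inv x \<otimes> \<nu> \<otimes> x) = f \<nu>" if "x \<in> carrier S" "\<nu> \<in> N" for x \<nu>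
    using f that by (auto simp: H1_invariant_def)
  have one_N: "\<one> \<in> N"
    using subgroup.one_closed[OF subgroup_N] .
  have f_one: "f \<one> = 0"
    using f_mult[OF one_N one_N] by simp
  have inv_N: "inv \<nu> \<in> N" if "\<nu> \<in> N" for \<nu>
    using subgroup.m_inv_closed[OF subgroup_N that] .
  have f_inv: "f \<nu> + f (inv \<nu>) = 0" if "\<nu> \<in> N" for \<nu>
    using f_mult[OF that inv_N[OF that]] N_closed[OF that] f_one by simp
  have pow: "\<nu> [^] k \<in> N \<and> f (\<nu> [^] k) = of_nat k * f \<nu>" if "\<nu> \<in> N" for \<nu> and k :: nat
    using that by (induction k)
      (simp_all add: one_N f_one f_mult subgroup.m_closed[OF subgroup_N] algebra_simps)
  have gen: "x \<in> ?D" if "x \<in> ?gen" for x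
    using that
  proof
    assume "x \<in> {\<nu> [^] m | \<nu>. \<nu> \<in> N}"
    then show ?thesis
      using pow m by auto
  next
    assume "x \<in> {inv \<sigma> \<otimes> inv \<nu> \<otimes> \<sigma> \<otimes> \<nu> | \<sigma> \<nu>. \<sigma> \<in> carrier S \<and> \<nu> \<in> N}"
    then obtain \<sigma> \<nu> where x: "x = inv \<sigma> \<otimes> inv \<nu> \<otimes> \<sigma> \<otimes> \<nu>" and \<sigma>: "\<sigma> \<in> carrier S" and \<nu>: "\<nu> \<in> N"
      by blast
    have c: "inv \<sigma> \<otimes> inv \<nu> \<otimes> \<sigma> \<in> N"
      by (rule conj_closed[OF \<sigma> inv_N[OF \<nu>]])
    have "f x = f (inv \<nu>) + f \<nu>"
      unfolding x f_mult[OF c \<nu>] f_conj[OF \<sigma> inv_N[OF \<nu>]] ..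
    moreover have "x \<in> N"
      unfolding x by (rule subgroup.m_closed[OF subgroup_N c \<nu>])
    ultimately show ?thesis
      using f_inv[OF \<nu>] by (simp add: add.commute)
  qed
  have sub: "generate S ?gen \<subseteq> ?D"
  proof
    fix x assume "x \<in> generate S ?gen"
    then show "x \<in> ?D"
    proof induction
      case one
      then show ?case
        using one_N f_one by simp
    next
      case (incl h)
      then show ?case
        by (rule gen)
    next
      case (inv h)
      then have "h \<in> ?D"
        by (rule gen)
      then show ?case
        using inv_N[of h] f_inv[of h] by simp
    next
      case (eng h1 h2)
      then show ?case
        using f_mult subgroup.m_closed[OF subgroup_N] by simp
    qed
  qed
  have "continuous_map (subtopology T N) (discrete_topology UNIV) f"
    using f by (simp add: H1_invariant_def H1_def C1_def)
  then have "closedin (subtopology T N) {\<nu> \<in> topspace (subtopology T N). f \<nu> \<in> {0}}"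
    by (rule closedin_continuous_map_preimage) simp
  then have "closedin T {\<nu> \<in> topspace (subtopology T N). f \<nu> \<in> {0}}"
    using closed_N closedin_trans_full by blast
  moreover have "{\<nu> \<in> topspace (subtopology T N). f \<nu> \<in> {0}} = ?D"
    using N_closed by (auto simp: topspace_eq)
  ultimately have "closedin T ?D"
    by simp
  with sub show "powers_commutators S T N m \<subseteq> ?D"
    unfolding powers_commutators_def by (rule closure_of_minimal)
  have "generate S ?gen \<subseteq> topspace T"
    using sub N_closed by (auto simp: topspace_eq)
  from closure_of_subset[OF this] show "\<one> \<in> powers_commutators S T N m"
    unfolding powers_commutators_def using generate.one by blast
qed

end

lemma (in free_profinite_group) coeff_one:
  assumes "w \<in> lists A"
  shows "\<epsilon> w \<one> = (if w = [] then 1 else 0 :: 'r::{finite,comm_ring_1})"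
proof -
  have "(magnus A S T \<iota> :: 's \<Rightarrow> 'a list \<Rightarrow> 'r) \<in> hom S (magnus_group A)"
    using magnus_in_continuous_hom unfolding continuous_hom_def by blast
  then have "(magnus A S T \<iota> \<one> :: 'a list \<Rightarrow> 'r) = \<one>\<^bsub>magnus_group A\<^esub>"
    by (rule hom_one[OF _ group_axioms group_magnus_group])
  then show ?thesis
    using assms by (simp add: magnus_coeff_def magnus_group_def power_series_def)
qed

theorem theorem9p2:
  fixes A :: "'a set" and S :: "'s monoid" and T :: "'s topology" and \<iota> :: "'a \<Rightarrow> 's"
    and N :: "'s set" and m n :: nat and w :: "'a list"
    and c :: "nat \<Rightarrow> nat \<Rightarrow> 's set \<Rightarrow> 'm::nontriv mod_ring"
  assumes "m = CARD('m)" and "m \<ge> 2" and "n \<ge> 2"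
    and "free_profinite_group A S T \<iota>"
    and "N \<lhd> S" and "closedin T N"
    and "N \<subseteq> magnus_filtration A S T \<iota> TYPE('m mod_ring) n"
    and "w \<in> lists A" and "length w = n"
    and "defining_system (S Mod N) (quotient_topology S T N) n c"
    and "\<And>i \<sigma>. \<lbrakk>1 \<le> i; i \<le> n; \<sigma> \<in> carrier S\<rbrakk>
           \<Longrightarrow> c i i (N #>\<^bsub>S\<^esub> \<sigma>) = magnus_coeff A S T \<iota> [w ! (i - 1)] \<sigma>"
    and "\<sigma> \<in> N"
  shows "trg_pairing S T N (powers_commutators S T N m #>\<^bsub>S\<^esub> \<sigma>)
           (H2_class (S Mod N) (quotient_topology S T N)
              (massey_tilde (S Mod N) c 1 n))
         = magnus_coeff A S T \<iota> w \<sigma>"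
proof -
  interpret free_profinite_group A S T \<iota>
    by fact
  interpret closed_normal_subgroup S T N
    by (intro closed_normal_subgroup.intro closed_normal_subgroup_axioms.intro profinite_group_axioms assms)
  \<comment> \<open>Defining systems use closed intervals from \<open>i\<close> to \<open>j\<close>,
    matrices the position \<open>(i, j + 1)\<close>; the diagonal \<open>c i i\<close> becomes the
    superdiagonal.\<close>
  define d where "d i k x = c i (k - 1) (\<pi> x)" for i k x
  have c: "c i j \<in> C1 Q TQ" "coboundary Q (c i j) = massey_tilde Q c i j"
    if "1 \<le> i" "i \<le> j" "j \<le> n" "(i, j) \<noteq> (1, n)" for i j
    using assms(10) that unfolding defining_system_def by blast+
  have massey: "massey_tilde Q c i j (\<pi> x, \<pi> x') = - (\<Sum>r\<in>{i<..<j + 1}. d i r x * d r (j + 1) x')"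
    if "x \<in> carrier S" "x' \<in> carrier S" for i j x x'
  proof -
    have "(\<Sum>r = i..<j. c i r (\<pi> x) * c (r + 1) j (\<pi> x')) = (\<Sum>r\<in>{i<..<j + 1}. d i r x * d r (j + 1) x')"
      unfolding d_def by (rule sum.reindex_bij_witness[of _ "\<lambda>r. r - 1" Suc]) auto
    then show ?thesis
      using that by (simp add: massey_tilde_def cup_def proj_closed)
  qed
  have d_cont: "continuous_map T (discrete_topology UNIV) (d i k)"
    if "1 \<le> i" "i < k" "k \<le> n + 1" "(i, k) \<noteq> (1, n + 1)" for i k
  proof -
    have "c i (k - 1) \<in> C1 Q TQ"
      using that by (intro c) auto
    then have "continuous_map TQ (discrete_topology UNIV) (c i (k - 1))"
      by (simp add: C1_def)
    from continuous_map_compose[OF continuous_proj this] show ?thesis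
      by (simp add: d_def[abs_def] o_def)
  qed
  have d_mult: "d i k (x \<otimes>\<^bsub>S\<^esub> x') = d i k x + d i k x' + (\<Sum>r\<in>{i<..<k}. d i r x * d r k x')"
    if "1 \<le> i" "i < k" "k \<le> n + 1" "(i, k) \<noteq> (1, n + 1)" "x \<in> carrier S" "x' \<in> carrier S" for i k x x'
  proof -
    have "coboundary Q (c i (k - 1)) (\<pi> x, \<pi> x') = massey_tilde Q c i (k - 1) (\<pi> x, \<pi> x')"
      using that by (subst c) auto
    then have "d i k x + d i k x' - d i k (x \<otimes>\<^bsub>S\<^esub> x') = - (\<Sum>r\<in>{i<..<k}. d i r x * d r k x')"
      using that massey[OF that(5,6), of i "k - 1"]
      by (simp add: coboundary_def proj_closed proj_mult d_def)
    then show ?thesis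
      by (simp add: algebra_simps)
  qed
  obtain y0 where y0_cont: "continuous_map T (discrete_topology UNIV) y0"
    and y0_mult: "\<And>x x'. x \<in> carrier S \<Longrightarrow> x' \<in> carrier S \<Longrightarrow>
      y0 (x \<otimes>\<^bsub>S\<^esub> x') = y0 x + y0 x' + (\<Sum>r\<in>{1<..<n + 1}. d 1 r x * d r (n + 1) x')"
    and y0_coeff: "\<And>x. x \<in> magnus_filtration A S T \<iota> TYPE('m mod_ring) n \<Longrightarrow> y0 x = \<epsilon> w x"
    using unitriangular_corner[OF assms(3,8,9) d_cont d_mult] assms(11) by (auto simp: d_def)
  define y where "y = restrict y0 (carrier S)"
  define b where "b = massey_tilde Q c 1 n"
  have one_N: "\<one>\<^bsub>S\<^esub> \<in> N"
    using subgroup.one_closed[OF subgroup_N] .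
  have y_cont: "continuous_map T (discrete_topology UNIV) y"
    using y0_cont by (rule continuous_map_eq) (simp add: y_def topspace_eq)
  have y_N: "y \<nu> = \<epsilon> w \<nu>" if "\<nu> \<in> N" for \<nu>
    using that assms(7) y0_coeff N_closed by (auto simp: y_def)
  have b_eq: "b (\<pi> x, \<pi> x') = y x + y x' - y (x \<otimes>\<^bsub>S\<^esub> x')" if "x \<in> carrier S" "x' \<in> carrier S" for x x'
    unfolding b_def massey[OF that] using that by (simp add: y_def y0_mult)
  have "b \<in> carrier (Z2 Q TQ)"
    using y_cont b_eq by (intro cocycle_of_inflation[of y]) (simp_all add: b_def massey_tilde_def)
  moreover have "y \<one>\<^bsub>S\<^esub> = 0"
    using y_N[OF one_N] assms(3,8,9) by (auto simp: coeff_one)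
  ultimately have y: "trg_cochain y b"
    using y_cont b_eq by (simp add: trg_cochain_def C1_def y_def)
  let ?f = "restrict y N"
  let ?P = "powers_commutators S T N m"
  have f: "?f \<in> H1_invariant S T N"
    by (rule trg_cochain_restrict[OF y])
  have f_eq: "the_inv_into (H1_invariant S T N) (trg S T N) (H2_class Q TQ b) = ?f"
    by (rule the_inv_into_f_eq[OF inj_on_trg[OF assms(5,6,3,7)] trg_eq[OF y] f])
  have P: "?P \<subseteq> {\<nu> \<in> N. ?f \<nu> = 0}" "\<one>\<^bsub>S\<^esub> \<in> ?P"
    using H1_invariant_vanishes[OF f, of m] assms(1) by simp_all
  have "?f x = \<epsilon> w \<sigma>" if x: "x \<in> ?P #>\<^bsub>S\<^esub> \<sigma>" for x
  proof -
    obtain p where p: "p \<in> ?P" "x = p \<otimes>\<^bsub>S\<^esub> \<sigma>"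
      using x by (auto simp: r_coset_def)
    then have "p \<in> N" "y p = 0"
      using P(1) by auto
    then show ?thesis
      using p(2) assms(12) y_N trg_cochain_mult_N(2)[OF y N_closed[OF assms(12)]]
        subgroup.m_closed[OF subgroup_N] by simp
  qed
  \<comment> \<open>The common value on the coset is unique only because the coset is not
    empty.\<close>
  moreover have "\<sigma> \<in> ?P #>\<^bsub>S\<^esub> \<sigma>"
    using P(2) N_closed[OF assms(12)] unfolding r_coset_def by force
  ultimately show ?thesis
    unfolding trg_pairing_def b_def[symmetric] f_eq by (intro the_equality) auto
qed

end
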